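(* Let $k\ge 2$ be an integer and let $D$ be a $3$-partite tournament with $\delta^+(D)\geq 2k-1$. Then $\kappa^k(D)=1$ if and only if the only nontrivial strong component of $D$ is the terminal strong component $D'$ of $D$, and $D'$ is a member of $BT(n_1,\ldots,n_{2k})$ for some integers $n_1,\ldots,n_{2k}$ with $n_i\geq 2k-1$ for all $i=1,\ldots,2k$.
   Context: Digraphs are finite and have no loops or parallel arcs. An orientation of an undirected graph $G$ is a digraph obtained by replacing each edge $\{x,y\}$ of $G$ with exactly one of the arcs $xy$ or $yx$. A $t$-partite tournament is an orientation of a complete multipartite graph with exactly $t$ (nonempty) partite sets; a bipartite tournament is a $2$-partite tournament. All cycles are directed cycles, and the length of a cycle is its number of arcs. $\delta^+(D)$ denotes the minimum out-degree of a vertex of $D$. For a set $\mathcal{C}$ of $k$ vertex-disjoint cycles of $D$, let $\kappa^k(\mathcal{C})$ be the maximum number of cycles in $\mathcal{C}$ of pairwise distinct lengths (i.e. the number of different lengths occurring among the cycles of $\mathcal{C}$). Let $\kappa^k(D)=\max\{\kappa^k(\mathcal{C}) : \mathcal{C}\text{ is a set of } k \text{ vertex-disjoint directed cycles in } D\}$. (When $D$ is a $3$-partite tournament with $\delta^+(D)\ge 2k-1$, such a set $\mathcal{C}$ always exists.) A strong component is a maximal strongly connected subdigraph; it is nontrivial if it has more than one vertex. The terminal strong component is the strong component with no arcs leaving it (the last one in an acyclic ordering of the strong components); it is unique for a multipartite tournament with minimum out-degree at least $1$. For an integer $k\ge 2$ and positive integers $n_1,\dots,n_{2k}$, a digraph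 $H$ belongs to $BT(n_1,n_2,\dots,n_{2k})$ if $H$ is a bipartite tournament with partite sets $X,Y$ such that (i) $X$ is the disjoint union of $X_1,\dots,X_{2k}$ with $|X_i|=n_i$ for every $i$, and $Y$ is the disjoint union of $Y_1,\dots,Y_{2k}$ with $|Y_i|=1$ for every $i$; and (ii) the arc set of $H$ is $\left(\bigcup_{1\le i\ne j\le 2k}A(X_i,Y_j)\right)\cup\left(\bigcup_{1\le i\le 2k}A(Y_i,X_i)\right)$, where $A(P,Q)$ is the set of arcs from $P$ to $Q$; that is, all arcs between $X_i$ and $Y_j$ go from $X_i$ to $Y_j$ when $i\neq j$, and all arcs between $X_i$ and $Y_i$ go from $Y_i$ to $X_i$. *)

theory Defs
  imports
    "Graph_Theory.Digraph"
    "Graph_Theory.Arc_Walk"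
    "Graph_Theory.Digraph_Component"
    "HOL-Library.Disjoint_Sets"
begin

text \<open>
  Finite digraphs without loops and parallel arcs are the locale predicate \<open>digraph\<close>; directed
  cycles (as arc lists) and strong components are the library's \<open>pre_digraph.cycle\<close> and
  \<open>pre_digraph.sccs\<close>.
\<close>

definition orientation_of :: "('a, 'b) pre_digraph \<Rightarrow> 'a set \<Rightarrow> 'a set set \<Rightarrow> bool" where
  "orientation_of D V E \<longleftrightarrow>
     digraph D \<and> verts D = V \<and>
     (\<forall>x y. {x, y} \<in> E \<longrightarrow> (x \<rightarrow>\<^bsub>D\<^esub> y) \<noteq> (y \<rightarrow>\<^bsub>D\<^esub> x)) \<and>
     (\<forall>x y. x \<rightarrow>\<^bsub>D\<^esub> y \<longrightarrow> {x, y} \<in> E)"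

definition complete_multipartite_edges :: "'a set set \<Rightarrow> 'a set set" where
  "complete_multipartite_edges P =
     {{x, y} | x y. \<exists>S\<in>P. \<exists>T\<in>P. S \<noteq> T \<and> x \<in> S \<and> y \<in> T}"

text \<open>\<^const>\<open>partition_on\<close> makes the partite sets nonempty and pairwise disjoint.\<close>

definition multipartite_tournament_on :: "'a set set \<Rightarrow> ('a, 'b) pre_digraph \<Rightarrow> bool" where
  "multipartite_tournament_on P D \<longleftrightarrow>
     partition_on (verts D) P \<and>
     orientation_of D (\<Union>P) (complete_multipartite_edges P)"

definition partite_tournament :: "nat \<Rightarrow> ('a, 'b) pre_digraph \<Rightarrow> bool" where
  "partite_tournament t D \<longleftrightarrow> (\<exists>P. finite P \<and> card P = t \<and> multipartite_tournament_on P D)"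

definition min_out_degree :: "('a, 'b) pre_digraph \<Rightarrow> nat" where
  "min_out_degree D = Min (out_degree D ` verts D)"

text \<open>
  The vertices of a cycle are the tails of its arcs.  A cycle corresponds to several arc lists
  (its rotations), but these share their vertices, so a family of vertex-disjoint cycles contains
  at most one of them and its cardinality counts cycles.
\<close>

definition disjoint_cycles :: "('a, 'b) pre_digraph \<Rightarrow> nat \<Rightarrow> 'b list set \<Rightarrow> bool" where
  "disjoint_cycles D k C \<longleftrightarrow>
     finite C \<and> card C = k \<and> (\<forall>p\<in>C. pre_digraph.cycle D p) \<and>
     (\<forall>p\<in>C. \<forall>q\<in>C. p \<noteq> q \<longrightarrow> tail D ` set p \<inter> tail D ` set q = {})"

definition num_lengths :: "'b list set \<Rightarrow> nat" where
  "num_lengths C = card (length ` C)"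

text \<open>
  On \<^typ>\<open>nat\<close>, \<^const>\<open>Sup\<close> is the maximum of a nonempty bounded set; the value is 0 if \<open>D\<close> has
  no \<open>k\<close> vertex-disjoint cycles.
\<close>

definition kappa :: "nat \<Rightarrow> ('a, 'b) pre_digraph \<Rightarrow> nat" where
  "kappa k D = Sup (num_lengths ` {C. disjoint_cycles D k C})"

lemma kappa_eq_Max:
  assumes "disjoint_cycles D k C"
  shows "kappa k D = Max (num_lengths ` {C. disjoint_cycles D k C})"
  using assms unfolding kappa_def Sup_nat_def by auto

lemma finite_num_lengths:
  "finite (num_lengths ` {C. disjoint_cycles D k C})"
  by (rule finite_subset[of _ "{..k}"])
    (auto simp: num_lengths_def disjoint_cycles_def intro: card_image_le)

definition nontrivial_scc :: "('a, 'b) pre_digraph \<Rightarrow> ('a, 'b) pre_digraph \<Rightarrow> bool" where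
  "nontrivial_scc D H \<longleftrightarrow> H \<in> pre_digraph.sccs D \<and> card (verts H) > 1"

definition terminal_scc :: "('a, 'b) pre_digraph \<Rightarrow> ('a, 'b) pre_digraph \<Rightarrow> bool" where
  "terminal_scc D H \<longleftrightarrow>
     H \<in> pre_digraph.sccs D \<and>
     \<not> (\<exists>e\<in>arcs D. tail D e \<in> verts H \<and> head D e \<notin> verts H)"

definition arcs_from_to :: "('a, 'b) pre_digraph \<Rightarrow> 'a set \<Rightarrow> 'a set \<Rightarrow> 'b set" where
  "arcs_from_to H P Q = {e \<in> arcs H. tail H e \<in> P \<and> head H e \<in> Q}"

text \<open>
  \<open>n\<close> stands for the tuple of its values at \<open>1, \<dots>, 2 * k\<close>; other values are irrelevant.
\<close>

definition BT :: "nat \<Rightarrow> (nat \<Rightarrow> nat) \<Rightarrow> ('a, 'b) pre_digraph set" where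
  "BT k n = {H. \<exists>X Y Xs Ys.
     X \<noteq> Y \<and> multipartite_tournament_on {X, Y} H \<and>
     X = (\<Union>i\<in>{1..2 * k}. Xs i) \<and> disjoint_family_on Xs {1..2 * k} \<and>
     (\<forall>i\<in>{1..2 * k}. card (Xs i) = n i) \<and>
     Y = (\<Union>i\<in>{1..2 * k}. Ys i) \<and> disjoint_family_on Ys {1..2 * k} \<and>
     (\<forall>i\<in>{1..2 * k}. card (Ys i) = 1) \<and>
     arcs H =
       (\<Union>i\<in>{1..2 * k}. \<Union>j\<in>{1..2 * k} - {i}. arcs_from_to H (Xs i) (Ys j)) \<union>
       (\<Union>i\<in>{1..2 * k}. arcs_from_to H (Ys i) (Xs i))}"

end

theory Submission
  imports Defs
begin

text \<open>
  Throughout, a vertex is coloured with its partite set, so two vertices are joined by an arc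
  exactly when their colours differ.  A shortest cycle inside the vertex set of a given cycle has
  length 3 or 4 (\<open>short_cyc_inside\<close>).  Call \<open>D\<close> uniform if the cycles of every packing of \<open>k\<close>
  disjoint cycles have one common length.

  Deleting a triangle from a 3-coloured tournament, or a 4-cycle from a 2-coloured one, costs each
  vertex at most two out-neighbours.  A strong component without triangles has only two colours
  (\<open>triangle_free_bipartite\<close>).  By induction on \<open>k\<close>, minimum out-degree \<open>2k - 1\<close> therefore forces
  \<open>k\<close> disjoint cycles (\<open>packing_exists\<close>), and \<open>kappa k D = 1\<close> says precisely that \<open>D\<close> is uniform.

  The heart of the proof is the case \<open>k = 2\<close> for a strong digraph \<open>S\<close> (\<open>small_colour_class\<close>), treated at
  once for triangles and for 4-cycles; let \<open>l\<close> be 3 or 4.  Remove an \<open>l\<close>-cycle \<open>p\<close> and let \<open>K\<close> be a terminal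
  strong component of the rest.  All cycles of \<open>K\<close> avoid \<open>p\<close>, so they have length \<open>l\<close>; hence \<open>K\<close> is a
  blow-up of an \<open>l\<close>-cycle (\<open>levels_exist\<close>) and one of its levels is a single vertex
  (\<open>level_singleton\<close>).  Choose an \<open>l\<close>-cycle \<open>q\<close> in \<open>K\<close>, remove it instead of \<open>p\<close>, and let \<open>K'\<close> be a terminal
  strong component of what is left.  A vertex with only one out-neighbour in \<open>K\<close> must dominate both
  of its neighbours on \<open>p\<close>, and this rigidity shows that \<open>K\<close> and \<open>K'\<close> partition \<open>S\<close>
  (\<open>two_terminals\<close>).  Vertices of \<open>K\<close> off \<open>q\<close> and vertices of \<open>K'\<close> off \<open>p\<close> cannot be adjacent, so they
  all share one colour.  For triangles this is contradictory; for 4-cycles the other colour class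
  consists of two vertices of \<open>p\<close> and two of \<open>q\<close>.

  Consequently a uniform \<open>D\<close> contains no triangle, since deleting disjoint triangles reduces to
  \<open>k = 2\<close> (\<open>uniform_no_triangle\<close>), so its terminal component is bipartite.  The same comparison of
  the terminal components left by two disjoint 4-cycles shows by induction on \<open>k\<close> that this component has a
  colour class with exactly \<open>2k\<close> vertices (\<open>uniform_colour_class\<close>).  A vertex of the other class has
  out-degree at least \<open>2k - 1\<close>, so it has a single in-neighbour, and this is the structure of \<open>BT\<close>.
  Such a component contains a 6-cycle and \<open>k - 2\<close> further disjoint cycles; a cycle elsewhere in
  \<open>D\<close> would complete a packing with two lengths (\<open>no_outside_cycle\<close>).

  Conversely, each cycle in a member of \<open>BT\<close> alternates between its two sides and uses at least two of the \<open>2k\<close>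
  vertices of the small side.  Then \<open>k\<close> disjoint cycles use exactly two each, so all
  have length 4 (\<open>packing_length_four\<close>).
\<close>

section \<open>Closed sets and cycles\<close>

lemma mod_add_cancel_nat: "(x + z) mod l = (y + z) mod l \<longleftrightarrow> x mod l = y mod (l::nat)"
proof (cases "x \<le> y")
  case True
  then show ?thesis using mod_eq_dvd_iff_nat[of "x + z" "y + z" l] mod_eq_dvd_iff_nat[of x y l] by auto
next
  case False
  then show ?thesis using mod_eq_dvd_iff_nat[of "y + z" "x + z" l] mod_eq_dvd_iff_nat[of y x l] by auto
qed

lemma ex_max_on:
  fixes f :: "'b \<Rightarrow> nat"
  assumes "finite A" "A \<noteq> {}"
  shows "\<exists>v\<in>A. \<forall>x\<in>A. f x \<le> f v"
proof -
  have "Max (f ` A) \<in> f ` A" using assms by (intro Max_in) auto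
  then obtain v where "v \<in> A" "f v = Max (f ` A)" by auto
  then show ?thesis using assms by (intro bexI[of _ v]) auto
qed

text \<open>
  An orientation of a complete multipartite graph, with \<open>c\<close> sending a vertex to its partite set.
  Induced subdigraphs are represented by their vertex sets, so that deleting a cycle is a set
  difference.
\<close>
locale coloured_tournament =
  fixes V :: "'a set" and E :: "'a \<Rightarrow> 'a \<Rightarrow> bool" and c :: "'a \<Rightarrow> 'c"
  assumes finite_V: "finite V"
    and arc_in: "E u v \<Longrightarrow> u \<in> V \<and> v \<in> V"
    and arc_colours: "E u v \<Longrightarrow> c u \<noteq> c v"
    and arc_total: "u \<in> V \<Longrightarrow> v \<in> V \<Longrightarrow> c u \<noteq> c v \<Longrightarrow> E u v \<or> E v u"
    and arc_asym: "E u v \<Longrightarrow> \<not> E v u"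
begin

definition outs :: "'a set \<Rightarrow> 'a \<Rightarrow> 'a set" where
  "outs S v = {u \<in> S. E v u}"

abbreviation outd :: "'a set \<Rightarrow> 'a \<Rightarrow> nat" where
  "outd S v \<equiv> card (outs S v)"

definition out_closed :: "'a set \<Rightarrow> 'a set \<Rightarrow> bool" where
  "out_closed S A \<longleftrightarrow> A \<subseteq> S \<and> (\<forall>u\<in>A. \<forall>v\<in>S. E u v \<longrightarrow> v \<in> A)"

text \<open>
  Having no proper nonempty out-closed subset is the same as strong connectivity.  In this form
  a terminal strong component is simply a minimal nonempty out-closed set.
\<close>
definition strong :: "'a set \<Rightarrow> bool" where
  "strong S \<longleftrightarrow> S \<noteq> {} \<and> (\<forall>A. out_closed S A \<and> A \<noteq> {} \<longrightarrow> A = S)"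

definition terminal :: "'a set \<Rightarrow> 'a set \<Rightarrow> bool" where
  "terminal S K \<longleftrightarrow> out_closed S K \<and> strong K"

definition step :: "'a set \<Rightarrow> 'a \<Rightarrow> 'a \<Rightarrow> bool" where
  "step S u v \<longleftrightarrow> u \<in> S \<and> v \<in> S \<and> E u v"

definition cyc :: "'a list \<Rightarrow> bool" where
  "cyc p \<longleftrightarrow> p \<noteq> [] \<and> distinct p \<and> (\<forall>i<length p. E (p ! i) (p ! (Suc i mod length p)))"

definition packing :: "'a set \<Rightarrow> nat \<Rightarrow> 'a list set \<Rightarrow> bool" where
  "packing S k F \<longleftrightarrow> finite F \<and> card F = k \<and> (\<forall>p\<in>F. cyc p \<and> set p \<subseteq> S) \<and>
     (\<forall>p\<in>F. \<forall>q\<in>F. p \<noteq> q \<longrightarrow> set p \<inter> set q = {})"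

definition uniform :: "'a set \<Rightarrow> nat \<Rightarrow> bool" where
  "uniform S k \<longleftrightarrow> (\<forall>F. packing S k F \<longrightarrow> (\<forall>p\<in>F. \<forall>q\<in>F. length p = length q))"

lemma finite_sub: "S \<subseteq> V \<Longrightarrow> finite S"
  using finite_V finite_subset by blast

lemma finite_outs [simp]: "finite (outs S v)"
  by (rule finite_subset[OF _ finite_V]) (auto simp: outs_def dest: arc_in)

lemma out_closed_trans: "out_closed S A \<Longrightarrow> out_closed A B \<Longrightarrow> out_closed S B"
  unfolding out_closed_def by blast

lemma terminal_exists:
  assumes "finite S" "S \<noteq> {}"
  shows "\<exists>K. terminal S K"
  using assms
proof (induction S rule: finite_psubset_induct)
  case (psubset S)
  show ?case
  proof (cases "strong S")
    case True
    then show ?thesis by (auto simp: terminal_def out_closed_def)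
  next
    case False
    then obtain A where A: "out_closed S A" "A \<noteq> {}" "A \<noteq> S"
      using psubset.prems unfolding strong_def by blast
    then have "A \<subset> S" by (auto simp: out_closed_def)
    from psubset.IH[OF this] A(2) obtain K where "terminal A K" by auto
    then show ?thesis using A(1) out_closed_trans unfolding terminal_def by blast
  qed
qed

lemma outs_closed: "out_closed S A \<Longrightarrow> v \<in> A \<Longrightarrow> outs A v = outs S v"
  unfolding out_closed_def outs_def by blast

lemma cyc_rotate_ind:
  assumes "cyc p" "i < length p" "p ! i \<in> A" "\<And>u v. u \<in> A \<Longrightarrow> u \<in> set p \<Longrightarrow> v \<in> set p \<Longrightarrow> E u v \<Longrightarrow> v \<in> A"
  shows "p ! ((i + n) mod length p) \<in> A"
proof (induction n)
  case 0 then show ?case using assms by simp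
next
  case (Suc n)
  let ?m = "(i + n) mod length p"
  have m: "?m < length p" using assms(2) by (auto intro!: mod_less_divisor)
  have "E (p ! ?m) (p ! (Suc ?m mod length p))" using assms(1) m unfolding cyc_def by blast
  moreover have "Suc ?m mod length p < length p" using assms(2) by (auto intro!: mod_less_divisor)
  then have "p ! (Suc ?m mod length p) \<in> set p" by simp
  moreover have "p ! ?m \<in> set p" using m by simp
  ultimately have "p ! (Suc ?m mod length p) \<in> A" using Suc assms(4)
    by blast
  then show ?case by (simp add: mod_Suc_eq)
qed

lemma cyc_absorbed:
  assumes "cyc p" "u \<in> set p" "u \<in> A" "\<And>u v. u \<in> A \<Longrightarrow> u \<in> set p \<Longrightarrow> v \<in> set p \<Longrightarrow> E u v \<Longrightarrow> v \<in> A"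
  shows "set p \<subseteq> A"
proof
  fix v assume "v \<in> set p"
  then obtain j where j: "j < length p" "p ! j = v" by (auto simp: in_set_conv_nth)
  obtain i where i: "i < length p" "p ! i = u" using assms(2) by (auto simp: in_set_conv_nth)
  have "p ! ((i + (length p - i + j)) mod length p) \<in> A"
    using cyc_rotate_ind[OF assms(1) i(1)] assms(3,4) i by blast
  moreover have "(i + (length p - i + j)) mod length p = j" using i j by simp
  ultimately show "v \<in> A" using j by simp
qed

lemma cyc_closed:
  assumes "cyc p" "set p \<subseteq> S" "out_closed S A" "set p \<inter> A \<noteq> {}"
  shows "set p \<subseteq> A"
proof -
  obtain u where "u \<in> set p" "u \<in> A" using assms(4) by auto
  then show ?thesis using assms(2,3) by (intro cyc_absorbed[OF assms(1)]) (auto simp: out_closed_def)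
qed

lemma walk_mono:
  assumes "(step S ^^ n) u v" "S \<subseteq> T"
  shows "(step T ^^ n) u v"
  using assms by (induction n arbitrary: v) (auto simp: step_def OO_def)

lemma walk_append: "(step S ^^ m) u v \<Longrightarrow> (step S ^^ n) v w \<Longrightarrow> (step S ^^ (m + n)) u w"
  by (auto simp: relpowp_add)

lemma strong_reach:
  assumes "strong S" "u \<in> S" "v \<in> S"
  shows "\<exists>n. (step S ^^ n) u v"
proof -
  let ?A = "{v \<in> S. \<exists>n. (step S ^^ n) u v}"
  have "out_closed S ?A" unfolding out_closed_def
  proof (intro conjI ballI impI)
    fix x y assume "x \<in> ?A" "y \<in> S" "E x y"
    then obtain n where "(step S ^^ n) u x" "step S x y" by (auto simp: step_def)
    then have "(step S ^^ Suc n) u y" by auto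
    then show "y \<in> ?A" using \<open>y \<in> S\<close> by blast
  qed auto
  moreover have "(step S ^^ 0) u u" by simp
  then have "u \<in> ?A" using assms by blast
  ultimately have "?A = S" using assms(1) unfolding strong_def by blast
  then show ?thesis using assms(3) by blast
qed

text \<open>
  A closed walk without repeated vertices is a cycle; at a repeated vertex it falls apart into two
  shorter closed walks.
\<close>
lemma closed_walk_split:
  assumes "(step S ^^ n) v v" "0 < n"
  shows "(\<exists>p. cyc p \<and> set p \<subseteq> S \<and> length p = n) \<or>
    (\<exists>m u w. 0 < m \<and> m < n \<and> (step S ^^ m) u u \<and> (step S ^^ (n - m)) w w)"
proof -
  obtain f where f: "f 0 = v" "f n = v" "\<And>i. i < n \<Longrightarrow> step S (f i) (f (Suc i))"
    using assms(1) unfolding relpowp_fun_conv by blast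
  have walk: "(step S ^^ d) (f i) (f (i + d))" if "i + d \<le> n" for i d
    unfolding relpowp_fun_conv using f(3) that by (intro exI[of _ "\<lambda>j. f (i + j)"]) auto
  show ?thesis
  proof (cases "inj_on f {0..<n}")
    case True
    let ?p = "map f [0..<n]"
    have "cyc ?p" unfolding cyc_def
    proof (intro conjI allI impI)
      fix i assume i: "i < length ?p"
      show "E (?p ! i) (?p ! (Suc i mod length ?p))"
      proof (cases "Suc i = n")
        case True then show ?thesis using f(3)[of i] f(1,2) i by (simp add: step_def)
      next
        case False then show ?thesis using f(3)[of i] i by (simp add: step_def)
      qed
    qed (use assms(2) True in \<open>auto simp: distinct_map\<close>)
    moreover have "set ?p \<subseteq> S" using f(3) by (auto simp: step_def)
    ultimately show ?thesis by (metis length_map length_upt minus_nat.diff_0)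
  next
    case False
    then obtain i j where ij: "i < j" "j < n" "f i = f j"
      unfolding inj_on_def by (metis atLeastLessThan_iff linorder_neqE_nat)
    have a: "(step S ^^ (j - i)) (f i) (f i)" using walk[of i "j - i"] ij by simp
    have b: "(step S ^^ i) v (f i)" using walk[of 0 i] f ij by simp
    have d: "(step S ^^ (n - j)) (f i) v" using walk[of j "n - j"] f ij by simp
    have e: "i + (n - j) = n - (j - i)" using ij by simp
    have w: "(step S ^^ (n - (j - i))) v v" using walk_append[OF b d] unfolding e .
    moreover have "0 < j - i" "j - i < n" using ij by auto
    ultimately show ?thesis using a by blast
  qed
qed

text \<open>Repeated splitting decomposes a closed walk into cycles.\<close>
lemma closed_walk_dvd:
  assumes "\<And>p. cyc p \<Longrightarrow> set p \<subseteq> S \<Longrightarrow> length p = l" "(step S ^^ n) v v"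
  shows "l dvd n"
  using assms(2)
proof (induction n arbitrary: v rule: less_induct)
  case (less n)
  show ?case
  proof (cases "n = 0")
    case False
    from closed_walk_split[OF less.prems] False consider
       p where "cyc p" "set p \<subseteq> S" "length p = n"
     | m u w where "0 < m" "m < n" "(step S ^^ m) u u" "(step S ^^ (n - m)) w w" by blast
    then show ?thesis
    proof cases
      case 1 then show ?thesis using assms(1) by (metis dvd_refl)
    next
      case 2
      then have "l dvd m" "l dvd n - m" using less.IH[of m] less.IH[of "n - m"] by auto
      then show ?thesis using 2 by (metis dvd_diffD less_imp_le)
    qed
  qed auto
qed

lemma cyc_walk:
  assumes "cyc p" "i \<le> j" "j < length p"
  shows "(step (set p) ^^ (j - i)) (p ! i) (p ! j)"
proof -
  have "(step (set p) ^^ d) (p ! i) (p ! (i + d))" if "i + d < length p" for d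
    using that
  proof (induction d)
    case (Suc d)
    have "E (p ! (i + d)) (p ! (Suc (i + d) mod length p))"
      using assms(1) Suc.prems unfolding cyc_def by (metis Suc_lessD add_Suc_right)
    then have "step (set p) (p ! (i + d)) (p ! (i + Suc d))" using Suc.prems by (auto simp: step_def)
    then show ?case using Suc by auto
  qed auto
  from this[of "j - i"] show ?thesis using assms by simp
qed

lemma cyc_wrap:
  assumes "cyc p" "j < length p"
  shows "(step (set p) ^^ (length p - j)) (p ! j) (p ! 0)"
proof -
  have n: "length p > 0" using assms by auto
  have "E (p ! (length p - 1)) (p ! (Suc (length p - 1) mod length p))"
    using assms(1) n unfolding cyc_def by (meson diff_less zero_less_one)
  then have s: "step (set p) (p ! (length p - 1)) (p ! 0)" using n by (simp add: step_def)
  have w: "(step (set p) ^^ (length p - 1 - j)) (p ! j) (p ! (length p - 1))"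
    using cyc_walk[OF assms(1), of j "length p - 1"] assms by simp
  have "(step (set p) ^^ Suc (length p - 1 - j)) (p ! j) (p ! 0)" using w s by auto
  moreover have e: "Suc (length p - 1 - j) = length p - j" using assms by simp
  ultimately show ?thesis unfolding e by -
qed

lemma cyc_ge3: "cyc p \<Longrightarrow> length p \<ge> 3"
proof (rule ccontr)
  assume p: "cyc p" "\<not> length p \<ge> 3"
  then have "length p \<noteq> 0" by (simp add: cyc_def)
  then have "length p = 1 \<or> length p = 2" using p(2) by linarith
  then show False
  proof
    assume l: "length p = 1"
    then have "E (p!0) (p!0)" using p unfolding cyc_def by force
    then show False using arc_asym by blast
  next
    assume l: "length p = 2"
    have "E (p!i) (p!(Suc i mod length p))" if "i < 2" for i using p l that unfolding cyc_def by simp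
    from this[of 0] this[of 1] have "E (p!0) (p!1)" "E (p!1) (p!0)" using l by simp_all
    then show False using arc_asym by blast
  qed
qed

lemma cyc_in_V: "cyc p \<Longrightarrow> set p \<subseteq> V"
  unfolding cyc_def using arc_in by (force simp: in_set_conv_nth)

text \<open>
  A closed walk of least length is a cycle without shortcuts.  If it had length at least 5, then
  its vertices 0 and 3 would be nonadjacent, since an arc between them in either direction gives a shorter
  closed walk; so they share a colour, vertex 1 is adjacent to vertex 3, and that arc gives a
  shorter closed walk as well.
\<close>
lemma short_cyc:
  assumes "(step S ^^ n) v v" "0 < n"
  shows "\<exists>p. cyc p \<and> set p \<subseteq> S \<and> (length p = 3 \<or> length p = 4)"
proof -
  let ?P = "\<lambda>n. 0 < n \<and> (\<exists>v. (step S ^^ n) v v)"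
  define m where "m = (LEAST n. ?P n)"
  have m: "?P m" unfolding m_def by (rule LeastI[of ?P n]) (use assms in blast)
  have least: "m \<le> n'" if "0 < n'" "(step S ^^ n') u u" for n' u
    unfolding m_def by (rule Least_le) (use that in blast)
  obtain v where v: "(step S ^^ m) v v" using m by blast
  have "\<exists>p. cyc p \<and> set p \<subseteq> S \<and> length p = m"
    using closed_walk_split[OF v] m least by (meson linorder_not_less)
  then obtain p where p: "cyc p" "set p \<subseteq> S" "length p = m" by blast
  (* Arcs between the vertices 0, 1 and 3 of p are confronted with the minimality of m. *)
  have "m < 5"
  proof (rule ccontr)
    assume "\<not> m < 5"
    then have l: "length p \<ge> 5" using p by simp
    have inV: "p ! i \<in> V" if "i < 5" for i using cyc_in_V[OF p(1)] l that by (meson nth_mem order_less_le_trans subsetD)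
    have inS: "p ! i \<in> S" if "i < 5" for i using p(2) l that by (meson nth_mem order_less_le_trans subsetD)
    have w03: "(step S ^^ 3) (p!0) (p!3)" using cyc_walk[OF p(1), of 0 3] l walk_mono[OF _ p(2)] by fastforce
    have w13: "(step S ^^ 2) (p!1) (p!3)" using cyc_walk[OF p(1), of 1 3] l walk_mono[OF _ p(2)] by fastforce
    have w30: "(step S ^^ (m - 3)) (p!3) (p!0)" using cyc_wrap[OF p(1), of 3] l p(3) walk_mono[OF _ p(2)] by fastforce
    have w01: "(step S ^^ 1) (p!0) (p!1)" using cyc_walk[OF p(1), of 0 1] l walk_mono[OF _ p(2)] by fastforce
    have sw: "(step S ^^ 1) (p!i) (p!j)" if "E (p!i) (p!j)" "i < 5" "j < 5" for i j
      using that inS by (auto simp: step_def)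
    show False
    proof (cases "c (p!0) = c (p!3)")
      case False
      then consider "E (p!0) (p!3)" | "E (p!3) (p!0)" using arc_total[OF inV[of 0] inV[of 3]] by auto
      then show False
      proof cases
        case 1
        have w: "(step S ^^ (1 + (m - 3))) (p!0) (p!0)" using walk_append[OF sw[OF 1] w30] by simp
        have "m \<le> 1 + (m - 3)" by (rule least[OF _ w]) simp
          then show False using l p(3) by simp
      next
        case 2
        have w: "(step S ^^ (3 + 1)) (p!0) (p!0)" using walk_append[OF w03 sw[OF 2]] by simp
        have "m \<le> 3 + 1" by (rule least[OF _ w]) simp
          then show False using l p(3) by simp
      qed
    next
      case True
      moreover have "E (p!0) (p!1)" using w01 by (auto simp: step_def)
      ultimately have "c (p!1) \<noteq> c (p!3)" using arc_colours by metis
      then consider "E (p!1) (p!3)" | "E (p!3) (p!1)" using arc_total[OF inV[of 1] inV[of 3]] by auto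
      then show False
      proof cases
        case 1
        have w: "(step S ^^ (1 + 1 + (m - 3))) (p!0) (p!0)"
          using walk_append[OF walk_append[OF w01 sw[OF 1]] w30] by simp
        have "m \<le> 1 + 1 + (m - 3)" by (rule least[OF _ w]) simp
          then show False using l p(3) by simp
      next
        case 2
        have w: "(step S ^^ (2 + 1)) (p!1) (p!1)" using walk_append[OF w13 sw[OF 2]] by simp
        have "m \<le> 2 + 1" by (rule least[OF _ w]) simp
          then show False using l p(3) by simp
      qed
    qed
  qed
  moreover have "m \<ge> 3" using cyc_ge3[OF p(1)] p(3) by simp
  ultimately have "m = 3 \<or> m = 4" by linarith
  then show ?thesis using p by auto
qed

lemma short_cyc_inside:
  assumes "cyc q"
  shows "\<exists>p. cyc p \<and> set p \<subseteq> set q \<and> (length p = 3 \<or> length p = 4)"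
proof -
  have "0 < length q" using assms by (auto simp: cyc_def)
  then show ?thesis using short_cyc[of "length q" "set q" "q!0"] cyc_wrap[OF assms, of 0] by auto
qed

text \<open>Following out-neighbours in a finite set must revisit a vertex.\<close>
lemma short_cyc_outd:
  assumes "finite S" "S \<noteq> {}" "\<And>v. v \<in> S \<Longrightarrow> 0 < outd S v"
  shows "\<exists>p. cyc p \<and> set p \<subseteq> S \<and> (length p = 3 \<or> length p = 4)"
proof -
  have "\<forall>v\<in>S. \<exists>u\<in>S. E v u" using assms(3) by (fastforce simp: outs_def card_gt_0_iff)
  then obtain g where g: "\<And>v. v \<in> S \<Longrightarrow> g v \<in> S \<and> E v (g v)" by metis
  obtain v0 where v0: "v0 \<in> S" using assms(2) by auto
  define h where "h n = (g ^^ n) v0" for n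
  have hS: "h n \<in> S" for n by (induction n) (auto simp: h_def v0 g)
  have hs: "step S (h n) (h (Suc n))" for n using hS[of n] g[of "h n"] by (simp add: step_def h_def)
  have walk: "(step S ^^ d) (h i) (h (i + d))" for i d
    by (induction d) (use hs in auto)
  have "\<not> inj h"
  proof
    assume "inj h"
    moreover have "range h \<subseteq> S" using hS by auto
    ultimately show False using assms(1) by (meson finite_subset finite_imageD infinite_UNIV_nat)
  qed
  then obtain i j where ij: "i < j" "h i = h j" unfolding inj_def by (metis linorder_neqE_nat)
  then have "(step S ^^ (j - i)) (h i) (h i)" using walk[of "j - i" i] by simp
  then show ?thesis using short_cyc ij by (metis zero_less_diff)
qed

lemma cyc_iff: "cyc p \<longleftrightarrow> p \<noteq> [] \<and> distinct p \<and> successively E p \<and> E (last p) (hd p)"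
proof (cases "p = []")
  case False
  then obtain n where n: "length p = Suc n" by (cases p) auto
  have "(\<forall>i<length p. E (p ! i) (p ! (Suc i mod length p))) \<longleftrightarrow>
    (\<forall>i. Suc i < length p \<longrightarrow> E (p ! i) (p ! Suc i)) \<and> E (p ! n) (p ! 0)"
    using n by (simp add: All_less_Suc) (metis (no_types, lifting) Suc_less_eq mod_less)
  then show ?thesis using False n
    by (simp add: cyc_def successively_conv_nth last_conv_nth hd_conv_nth)
qed (simp add: cyc_def)

section \<open>Strong digraphs whose cycles all have one length\<close>

text \<open>
  The set \<open>K\<close> induces a blow-up of the directed cycle of length \<open>l\<close>: each vertex of the cycle is replaced by a
  nonempty independent set.
\<close>
definition levels :: "'a set \<Rightarrow> nat \<Rightarrow> ('a \<Rightarrow> nat) \<Rightarrow> bool" where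
  "levels K l f \<longleftrightarrow> (\<forall>u\<in>K. f u < l) \<and> (\<forall>i<l. \<exists>u\<in>K. f u = i) \<and>
     (\<forall>u\<in>K. \<forall>v\<in>K. E u v \<longleftrightarrow> f v = Suc (f u) mod l)"

text \<open>
  In a strong set with at least one arc no vertex is a sink and none is a source: a sink would be
  an out-closed set, and so would the complement of a source.
\<close>
lemma strong_out:
  assumes "strong K" "E a b" "a \<in> K" "b \<in> K" "u \<in> K"
  shows "\<exists>v\<in>K. E u v"
proof (rule ccontr)
  assume "\<not> (\<exists>v\<in>K. E u v)"
  then have "out_closed K {u}" using assms(5) by (auto simp: out_closed_def)
  then have "K = {u}" using assms(1) unfolding strong_def by blast
  then show False using assms(2-4) arc_asym by blast
qed

lemma strong_in:
  assumes "strong K" "E a b" "a \<in> K" "b \<in> K" "v \<in> K"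
  shows "\<exists>u\<in>K. E u v"
proof (rule ccontr)
  assume no: "\<not> (\<exists>u\<in>K. E u v)"
  then have "out_closed K (K - {v})" by (auto simp: out_closed_def)
  moreover have "a \<noteq> b" using assms(2) arc_asym by blast
  then have "K - {v} \<noteq> {}" using assms by auto
  ultimately show False using assms(1,5) unfolding strong_def by blast
qed

text \<open>
  Since \<open>l\<close> divides the length of every closed walk, the length modulo \<open>l\<close> of a walk from a root to
  a vertex does not depend on the walk; this is the level.  Vertices on consecutive levels are adjacent:
  otherwise \<open>v\<close> and \<open>u\<close> would share a colour, and an out-neighbour of \<open>u\<close>, lying on the level of \<open>v\<close>,
  would share it too.
\<close>
lemma levels_exist:
  assumes K: "strong K" "K \<subseteq> V" and ab: "E a b" "a \<in> K" "b \<in> K"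
    and cycs: "\<And>p. cyc p \<Longrightarrow> set p \<subseteq> K \<Longrightarrow> length p = l" and l: "l \<ge> 3"
  shows "\<exists>f. levels K l f"
proof -
  define d where "d v = (SOME n. (step K ^^ n) a v)" for v
  have d: "(step K ^^ d v) a v" if "v \<in> K" for v
    unfolding d_def using someI_ex[OF strong_reach[OF K(1) ab(2) that]] .
  define f where "f v = d v mod l" for v
  have fl: "f v < l" for v using l by (simp add: f_def)
  have arc: "f v = Suc (f u) mod l" if uv: "u \<in> K" "v \<in> K" "E u v" for u v
  proof -
    obtain n where n: "(step K ^^ n) v a" using strong_reach[OF K(1) uv(2) ab(2)] by blast
    have "step K u v" using that by (simp add: step_def)
    then have "(step K ^^ Suc (d u)) a v" using d[OF that(1)] by auto
    from closed_walk_dvd[OF cycs walk_append[OF this n]] have 1: "l dvd (Suc (d u) + n)" by blast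
    from closed_walk_dvd[OF cycs walk_append[OF d[OF that(2)] n]] have 2: "l dvd (d v + n)" by blast
    have "(d v + n) mod l = (Suc (d u) + n) mod l" using 1 2 by (simp add: mod_eq_0_iff_dvd)
    then have "d v mod l = Suc (d u) mod l" unfolding mod_add_cancel_nat .
    then show ?thesis by (simp add: f_def mod_Suc_eq)
  qed
  have ex: "\<exists>u\<in>K. f u = i" if "i < l" for i
    using that
  proof (induction i)
    case 0
    have "l dvd d a" using closed_walk_dvd[OF cycs d[OF ab(2)]] by blast
    then have "f a = 0" by (simp add: f_def)
    then show ?case using ab by blast
  next
    case (Suc i)
    then obtain u where u: "u \<in> K" "f u = i" by auto
    then obtain v where "v \<in> K" "E u v" using strong_out[OF K(1) ab] by blast
    then show ?case using arc[OF u(1)] u Suc.prems by force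
  qed
  have rev: "E u v" if uv: "u \<in> K" "v \<in> K" "f v = Suc (f u) mod l" for u v
  proof (rule ccontr)
    assume no: "\<not> E u v"
    have noback: "\<not> E x y" if "f x = Suc (f y) mod l" "x \<in> K" "y \<in> K" for x y
    proof
      assume "E x y"
      then have "f y = Suc (f x) mod l" using arc that by blast
      then have "f y = Suc (Suc (f y) mod l) mod l" using that by simp
      then have "f y = Suc (Suc (f y)) mod l" by (simp add: mod_Suc_eq)
      then show False using fl[of y] l by (auto simp: mod_if split: if_splits)
    qed
    have same: "\<not> E x y" if "f x = f y" "x \<in> K" "y \<in> K" for x y
    proof
      assume "E x y"
      then have "f y = Suc (f y) mod l" using arc that by metis
      then show False using fl[of y] l by (auto simp: mod_if split: if_splits)
    qed
    have "c u = c v" using no noback[OF uv(3,2,1)] arc_total uv K(2) by blast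
    moreover obtain u' where u': "u' \<in> K" "E u u'" using strong_out[OF K(1) ab uv(1)] by blast
    moreover have "f u' = f v" using arc u' uv by metis
    then have "\<not> E u' v" "\<not> E v u'" using same u'(1) uv(2) by simp_all
    then have "c u' = c v" using arc_total[of u' v] u'(1) uv(2) K(2) by blast
    ultimately show False using arc_colours by metis
  qed
  show ?thesis unfolding levels_def using fl ex arc rev by blast
qed

text \<open>Levels may be renumbered cyclically, so that any chosen level becomes level 0.\<close>
lemma levels_shift:
  assumes "levels K l f" "i < l"
  shows "levels K l (\<lambda>v. (f v + (l - i)) mod l)"
proof -
  let ?g = "\<lambda>v. (f v + (l - i)) mod l"
  have l: "0 < l" using assms(2) by simp
  have inj: "(x + (l - i)) mod l = (y + (l - i)) mod l \<longleftrightarrow> x mod l = y mod l" for x y by (rule mod_add_cancel_nat)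
  have S: "Suc ((x + (l - i)) mod l) mod l = (Suc x + (l - i)) mod l" for x by (simp add: mod_Suc_eq)
  have "\<exists>u\<in>K. ?g u = j" if "j < l" for j
  proof -
    obtain u where u: "u \<in> K" "f u = (j + i) mod l" using assms(1) l unfolding levels_def by (meson mod_less_divisor)
    have "?g u = (j + i + (l - i)) mod l" unfolding u(2) by (simp add: mod_add_left_eq)
    also have "\<dots> = j" using that assms(2) by simp
    finally show ?thesis using u by blast
  qed
  moreover have "E u v \<longleftrightarrow> ?g v = Suc (?g u) mod l" if "u \<in> K" "v \<in> K" for u v
  proof -
    have "E u v \<longleftrightarrow> f v mod l = Suc (f u) mod l" using assms(1) that unfolding levels_def by auto
    then show ?thesis unfolding S inj .
  qed
  ultimately show ?thesis unfolding levels_def using l by simp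
qed

lemma levels_pos: "levels K l f \<Longrightarrow> u \<in> K \<Longrightarrow> 0 < l"
  unfolding levels_def by fastforce

lemma transversal_cyc:
  assumes "levels K l f" "0 < l" "\<And>i. i < l \<Longrightarrow> t i \<in> K \<and> f (t i) = i"
  shows "cyc (map t [0..<l])"
  unfolding cyc_def
proof (intro conjI allI impI)
  show "distinct (map t [0..<l])" using assms(3) by (auto simp: distinct_map intro!: inj_onI) (metis assms(3))
next
  fix i assume "i < length (map t [0..<l])"
  then have i: "i < l" by simp
  then have j: "Suc i mod l < l" by simp
  have "E (t i) (t (Suc i mod l))" using assms(1) assms(3)[OF i] assms(3)[OF j] unfolding levels_def by auto
  then show "E (map t [0..<l] ! i) (map t [0..<l] ! (Suc i mod length (map t [0..<l])))" using i j by simp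
qed (use assms(2) in simp)

text \<open>
  With two vertices on every level one could wind around twice, obtaining a cycle of length
  \<open>2 * l\<close>.
\<close>
lemma level_singleton:
  assumes lev: "levels K l f" "l > 0" and no: "\<not> (\<exists>p. cyc p \<and> set p \<subseteq> K \<and> length p = 2 * l)"
  shows "\<exists>w\<in>K. \<forall>u\<in>K. f u = f w \<longrightarrow> u = w"
proof (rule ccontr)
  assume neg: "\<not> ?thesis"
  have "\<forall>i<l. \<exists>x y. x \<in> K \<and> y \<in> K \<and> f x = i \<and> f y = i \<and> x \<noteq> y"
  proof (intro allI impI)
    fix i assume "i < l"
    then obtain x where x: "x \<in> K" "f x = i" using lev(1) unfolding levels_def by blast
    then obtain y where "y \<in> K" "f y = f x" "y \<noteq> x" using neg by blast
    then show "\<exists>x y. x \<in> K \<and> y \<in> K \<and> f x = i \<and> f y = i \<and> x \<noteq> y" using x by blast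
  qed
  then obtain a b where ab: "\<And>i. i < l \<Longrightarrow> a i \<in> K \<and> b i \<in> K \<and> f (a i) = i \<and> f (b i) = i \<and> a i \<noteq> b i" by metis
  define t where "t i = (if i < l then a i else b (i - l))" for i
  have t: "t i \<in> K \<and> f (t i) = i mod l" if "i < 2 * l" for i
    using that ab[of i] ab[of "i - l"] by (auto simp: t_def mod_if)
  have "inj_on t {0..<2*l}"
  proof (rule inj_onI)
    fix i j assume ij: "i \<in> {0..<2*l}" "j \<in> {0..<2*l}" "t i = t j"
    then have m: "i mod l = j mod l" using t by (metis atLeastLessThan_iff)
    show "i = j"
    proof (cases "i < l"; cases "j < l")
      assume "i < l" "\<not> j < l"
      moreover from this have "j - l = i" using m ij by (auto simp: mod_if)
      ultimately show ?thesis using ij(3) ab[of i] by (simp add: t_def)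
    next
      assume "\<not> i < l" "j < l"
      moreover from this have "i - l = j" using m ij by (auto simp: mod_if)
      ultimately show ?thesis using ij(3) ab[of j] by (simp add: t_def)
    qed (use m ij in \<open>auto simp: mod_if split: if_splits\<close>)
  qed
  moreover have "E (t i) (t (Suc i mod (2 * l)))" if i: "i < 2 * l" for i
  proof -
    have j: "Suc i mod (2*l) < 2*l" using lev(2) by simp
    have "Suc i mod (2 * l) mod l = Suc (i mod l) mod l" by (simp add: mod_mod_cancel mod_Suc_eq)
    then show ?thesis using lev(1) t[OF i] t[OF j] unfolding levels_def by auto
  qed
  ultimately have "cyc (map t [0..<2*l])" unfolding cyc_def using lev(2) by (auto simp: distinct_map)
  moreover have "set (map t [0..<2*l]) \<subseteq> K" using t by auto
  ultimately show False using no by (metis length_map length_upt minus_nat.diff_0)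
qed

text \<open>Along an arc the level increases by one modulo \<open>l\<close>, so \<open>l\<close> consecutive vertices have distinct levels.\<close>
lemma cyc_level:
  assumes "levels K l f" "cyc p" "set p \<subseteq> K" "length p = l" "x \<in> set p" "y \<in> set p" "f x = f y"
  shows "x = y"
proof -
  have l: "0 < l" using assms(2,4) by (auto simp: cyc_def)
  have pi: "f (p ! i) = (f (p ! 0) + i) mod l" if "i < l" for i
    using that
  proof (induction i)
    case 0 
    have "p ! 0 \<in> K" using assms(3,4) l by (meson nth_mem subsetD)
    then show ?case using assms(1) by (simp add: levels_def)
  next
    case (Suc i)
    have "E (p ! i) (p ! (Suc i mod length p))" using assms(2,4) Suc.prems unfolding cyc_def by (metis Suc_lessD)
    then have "E (p ! i) (p ! Suc i)" using Suc.prems assms(4) by simp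
    moreover have "p ! i \<in> K" "p ! Suc i \<in> K" using assms(3,4) Suc.prems by (auto simp: subset_iff)
    ultimately have "f (p ! Suc i) = Suc (f (p ! i)) mod l" using assms(1) unfolding levels_def by blast
    then show ?case using Suc by (simp add: mod_Suc_eq)
  qed
  obtain i j where ij: "i < l" "j < l" "p ! i = x" "p ! j = y" using assms(4,5,6) by (metis in_set_conv_nth)
  then have "(f (p!0) + i) mod l = (f (p!0) + j) mod l" using pi assms(7) by metis
  then have "i mod l = j mod l"
    using mod_add_cancel_nat[of i "f (p!0)" l j] by (simp add: add.commute)
  then show ?thesis using ij by simp
qed

section \<open>Packings of cycles\<close>

lemma uniform_two:
  assumes "uniform S 2" "cyc p" "cyc q" "set p \<subseteq> S" "set q \<subseteq> S" "set p \<inter> set q = {}"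
  shows "length p = length q"
proof -
  have "p \<noteq> q" using assms(2,6) by (auto simp: cyc_def)
  then have "packing S 2 {p, q}" using assms by (auto simp: packing_def)
  then show ?thesis using assms(1) unfolding uniform_def by blast
qed

text \<open>The packing may come from a component \<open>T\<close> of what is left after deleting \<open>p\<close>.\<close>
lemma packing_insert:
  assumes "packing T k F" "cyc p" "set p \<subseteq> S" "T \<subseteq> S - set p"
  shows "packing S (Suc k) (insert p F)"
proof -
  have "p \<notin> F" using assms unfolding packing_def cyc_def
    by (meson Diff_iff hd_in_set subset_iff)
  then show ?thesis using assms unfolding packing_def by (auto simp: subset_iff disjoint_iff)
qed

lemma packing_mono: "packing S k F \<Longrightarrow> S \<subseteq> T \<Longrightarrow> packing T k F"
  unfolding packing_def by blast

lemma uniform_mono: "uniform T k \<Longrightarrow> S \<subseteq> T \<Longrightarrow> uniform S k"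
  unfolding uniform_def using packing_mono by blast

lemma uniform_remove:
  assumes "uniform S (Suc k)" "cyc p" "set p \<subseteq> S"
  shows "uniform (S - set p) k"
  using assms packing_insert[OF _ assms(2,3)] unfolding uniform_def by (meson insertI2 order_refl)

lemma uniform_same:
  assumes "uniform S (Suc k)" "cyc p" "set p \<subseteq> S" "packing (S - set p) k F" "q \<in> F"
  shows "length q = length p"
  using packing_insert[OF assms(4,2,3)] assms(1,5) unfolding uniform_def by blast

section \<open>Triangle-free strong digraphs are bipartite\<close>

text \<open>
  Consider \<open>u \<rightarrow> v \<rightarrow> w\<close> with three distinct colours and a walk from \<open>w\<close> back to \<open>u\<close>.  Without
  triangles every path with two arcs and distinctly coloured ends is closed by an arc from its first to its last vertex,
  and with these arcs another path of the same kind is found whose walk back is shorter by one or two steps.  So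
  induction on the length of the walk back applies.
\<close>
lemma triangle_free_transitive_end:
  assumes tf: "\<And>p. cyc p \<Longrightarrow> set p \<subseteq> K \<Longrightarrow> length p \<noteq> 3" and K: "K \<subseteq> V"
    and cols: "\<And>z. z \<in> K \<Longrightarrow> c z \<in> {\<alpha>, \<beta>, \<gamma>}"
    and uvw: "u \<in> K" "v \<in> K" "w \<in> K" "E u v" "E v w" "c u \<noteq> c w" "(step K ^^ n) w u"
  shows False
  using uvw
proof (induction n arbitrary: u v w rule: less_induct)
  case (less n)
  note L = less.prems
  have tri: "E x z" if "x \<in> K" "y \<in> K" "z \<in> K" "E x y" "E y z" "c x \<noteq> c z" for x y z
  proof (rule ccontr)
    assume "\<not> E x z"
    then have "E z x" using arc_total that K by blast
    then have "cyc [x, y, z]" using that arc_colours[of x y] arc_colours[of y z] by (auto simp: cyc_iff)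
    then show False using tf[of "[x, y, z]"] that by auto
  qed
  have "c u \<noteq> c v" "c v \<noteq> c w" using L arc_colours by auto
  then have three: "c z = c u \<or> c z = c v \<or> c z = c w" if "z \<in> K" for z
    using cols[OF that] cols[OF L(1)] cols[OF L(2)] cols[OF L(3)] L(6) by auto
  have uw: "E u w" using tri L by blast
  have "w \<noteq> u" using L(6) by auto
  then obtain n' where n: "n = Suc n'" using L(7) by (cases n) auto
  then obtain z1 where z1: "step K w z1" "(step K ^^ n') z1 u" using L(7) by (meson relpowp_Suc_D2)
  have z1K: "z1 \<in> K" "E w z1" using z1 by (auto simp: step_def)
  have c1: "c z1 = c u"
  proof (rule ccontr)
    assume "c z1 \<noteq> c u"
    then have "c u \<noteq> c z1" by simp
    then show False using less.IH[of n' u w z1] n L z1K z1(2) uw by auto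
  qed
  have "z1 \<noteq> u" using z1K uw arc_asym by blast
  then obtain n'' where n': "n' = Suc n''" using z1(2) by (cases n') auto
  then obtain z2 where z2: "step K z1 z2" "(step K ^^ n'') z2 u" using z1(2) by (meson relpowp_Suc_D2)
  have z2K: "z2 \<in> K" "E z1 z2" using z2 by (auto simp: step_def)
  have "c v \<noteq> c z1" using c1 \<open>c u \<noteq> c v\<close> by simp
  then have vz1: "E v z1" using tri L z1K by blast
  have c2: "c u \<noteq> c z2" using z2K arc_colours c1 by metis
  consider "c z2 = c v" | "c z2 = c w" using three[OF z2K(1)] c2 by auto
  then show False
  proof cases
    case 1
    then have "E w z2" using tri[of w z1 z2] L z1K z2K \<open>c v \<noteq> c w\<close> by simp
    then show False using less.IH[of n'' u w z2] n n' L z2K z2(2) uw c2 by auto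
  next
    case 2
    then have "E v z2" using tri[of v z1 z2] L z1K z2K \<open>c v \<noteq> c w\<close> vz1 by simp
    then show False using less.IH[of n'' u v z2] n n' L z2K z2(2) c2 by auto
  qed
qed

text \<open>
  By the previous lemma and strong connectivity, the ends of every path with two arcs share a
  colour.  So from any arc \<open>a \<rightarrow> b\<close> onwards the colours of \<open>a\<close> and \<open>b\<close> alternate along all walks.
\<close>
lemma triangle_free_bipartite:
  assumes tf: "\<And>p. cyc p \<Longrightarrow> set p \<subseteq> K \<Longrightarrow> length p \<noteq> 3" and K: "strong K" "K \<subseteq> V"
    and cols: "card (c ` K) \<le> 3"
  shows "card (c ` K) \<le> 2"
proof (rule ccontr)
  assume "\<not> card (c ` K) \<le> 2"
  then have "card (c ` K) = 3" using cols by simp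
  then obtain \<alpha> \<beta> \<gamma> where abc: "c ` K = {\<alpha>, \<beta>, \<gamma>}" "\<alpha> \<noteq> \<beta>" "\<alpha> \<noteq> \<gamma>" "\<beta> \<noteq> \<gamma>"
    by (auto simp: card_Suc_eq numeral_3_eq_3)
  then have "\<alpha> \<in> c ` K" "\<beta> \<in> c ` K" by auto
  then obtain x y where "x \<in> K" "y \<in> K" "c x \<noteq> c y" using abc(2) by (metis imageE)
  then obtain a b where ab: "a \<in> K" "b \<in> K" "E a b" using arc_total K(2) by blast
  define A where "A = {z \<in> K. (c z = c b \<and> (\<exists>y\<in>K. E y z \<and> c y = c a)) \<or> (c z = c a \<and> (\<exists>y\<in>K. E y z \<and> c y = c b))}"
  have no: "c u = c w" if uvw: "u \<in> K" "v \<in> K" "w \<in> K" "E u v" "E v w" for u v w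
  proof (rule ccontr)
    assume "c u \<noteq> c w"
    moreover obtain n where "(step K ^^ n) w u" using strong_reach[OF K(1) uvw(3,1)] by blast
    ultimately show False using triangle_free_transitive_end[OF tf K(2), of \<alpha> \<beta> \<gamma> u v w n] abc uvw by blast
  qed
  have "out_closed K A" unfolding out_closed_def
  proof (intro conjI ballI impI)
    fix z t assume z: "z \<in> A" "t \<in> K" "E z t"
    then obtain y where y: "y \<in> K" "E y z" "(c z = c b \<and> c y = c a) \<or> (c z = c a \<and> c y = c b)" "z \<in> K"
      unfolding A_def by blast
    then have "c y = c t" using no z by blast
    then show "t \<in> A" unfolding A_def using y z by auto
  qed (auto simp: A_def)
  moreover have "b \<in> A" using ab by (auto simp: A_def)
  ultimately have "A = K" using K(1) unfolding strong_def by blast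
  then have "c ` K \<subseteq> {c a, c b}" by (auto simp: A_def)
  then have "card (c ` K) \<le> 2" using card_mono[of "{c a, c b}" "c ` K"] by (cases "c a = c b") auto
  then show False using \<open>card (c ` K) = 3\<close> by simp
qed

section \<open>Removing a triangle or a 4-cycle\<close>

text \<open>
  These are the two situations in which every vertex of \<open>S\<close> is adjacent to exactly two vertices of each
  \<open>l\<close>-cycle in \<open>S\<close> (\<open>fits_adj\<close> below): triangles with at most three colours, 4-cycles with at most two.
\<close>
definition fits :: "nat \<Rightarrow> 'a set \<Rightarrow> bool" where
  "fits l S \<longleftrightarrow> S \<subseteq> V \<and> (l = 3 \<and> card (c ` S) \<le> 3 \<or> l = 4 \<and> card (c ` S) \<le> 2)"

lemma cyc3E:
  assumes "cyc p" "length p = 3"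
  obtains x y z where "p = [x, y, z]" "E x y" "E y z" "E z x"
proof -
  obtain x y z where "p = [x, y, z]" using assms(2) by (auto simp: length_Suc_conv numeral_3_eq_3)
  then show thesis using that assms(1) by (auto simp: cyc_iff)
qed

lemma cyc4E:
  assumes "cyc p" "length p = 4"
  obtains x y z w where "p = [x, y, z, w]" "E x y" "E y z" "E z w" "E w x"
proof -
  obtain x y z w where "p = [x, y, z, w]" using assms(2) by (auto simp: length_Suc_conv eval_nat_numeral)
  then show thesis using that assms(1) by (auto simp: cyc_iff)
qed

lemma card_colours_mono: "finite S \<Longrightarrow> T \<subseteq> S \<Longrightarrow> card (c ` T) \<le> card (c ` S)"
  by (simp add: card_mono image_mono)

lemma fits_mono: "fits l S \<Longrightarrow> T \<subseteq> S \<Longrightarrow> fits l T"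
  unfolding fits_def using card_colours_mono[of S T] finite_sub[of S] by auto

lemma two_colours_eq:
  assumes "S \<subseteq> V" "card (c ` S) \<le> 2" "x \<in> S" "y \<in> S" "z \<in> S" "c x \<noteq> c y"
  shows "c z = c x \<or> c z = c y"
proof (rule ccontr)
  assume "\<not> ?thesis"
  then have "card {c x, c y, c z} = 3" using assms(6) by auto
  moreover have "card {c x, c y, c z} \<le> card (c ` S)"
    using assms finite_sub by (intro card_mono) auto
  ultimately show False using assms(2) by simp
qed

lemma three_colours_eq:
  assumes "S \<subseteq> V" "card (c ` S) \<le> 3" "x \<in> S" "y \<in> S" "z \<in> S" "u \<in> S" "c x \<noteq> c y" "c y \<noteq> c z" "c z \<noteq> c x"
  shows "c u = c x \<or> c u = c y \<or> c u = c z"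
proof (rule ccontr)
  assume "\<not> ?thesis"
  then have "card {c x, c y, c z, c u} = 4" using assms(7-9) by auto
  moreover have "card {c x, c y, c z, c u} \<le> card (c ` S)"
    using assms finite_sub by (intro card_mono) auto
  ultimately show False using assms(2) by simp
qed

text \<open>
  A triangle contains each of the three colours once, and a 4-cycle each of the two colours twice.
\<close>
lemma fits_adj:
  assumes "fits l S" "cyc p" "set p \<subseteq> S" "length p = l" "v \<in> S"
  shows "card {u \<in> set p. c u \<noteq> c v} = 2"
proof -
  consider "l = 3" "card (c ` S) \<le> 3" | "l = 4" "card (c ` S) \<le> 2" using assms(1) by (auto simp: fits_def)
  then show ?thesis
  proof cases
    case 1
    obtain x y z where p: "p = [x, y, z]" "E x y" "E y z" "E z x" using cyc3E assms 1 by metis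
    note ar = arc_colours[OF p(2)] arc_colours[OF p(3)] arc_colours[OF p(4)]
    have "c v = c x \<or> c v = c y \<or> c v = c z"
      using three_colours_eq[of S x y z v] assms 1 p(1) ar by (auto simp: fits_def)
    moreover have "{u \<in> set p. c u \<noteq> c x} = {y, z}" "{u \<in> set p. c u \<noteq> c y} = {x, z}"
      "{u \<in> set p. c u \<noteq> c z} = {x, y}"
      using ar p(1) by auto
    moreover have "x \<noteq> y" "y \<noteq> z" "x \<noteq> z" using ar by auto
    ultimately show ?thesis by (elim disjE) simp_all
  next
    case 2
    obtain x y z w where p: "p = [x, y, z, w]" "E x y" "E y z" "E z w" "E w x" using cyc4E assms 2 by metis
    note ar = arc_colours[OF p(2)] arc_colours[OF p(3)] arc_colours[OF p(4)] arc_colours[OF p(5)]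
    have S: "x \<in> S" "y \<in> S" "z \<in> S" "w \<in> S" "S \<subseteq> V" using assms p(1) by (auto simp: fits_def)
    have "c z = c x" "c w = c y" using two_colours_eq[of S x y z] two_colours_eq[of S x y w] S 2 ar by auto
    moreover have "c v = c x \<or> c v = c y" using two_colours_eq[of S x y v] S 2 ar assms(5) by auto
    moreover from calculation have "{u \<in> set p. c u \<noteq> c x} = {y, w}" "{u \<in> set p. c u \<noteq> c y} = {x, z}"
      using ar p(1) by auto
    moreover have "y \<noteq> w" "x \<noteq> z" using assms(2) p(1) by (auto simp: cyc_def)
    ultimately show ?thesis by (elim disjE) simp_all
  qed
qed

lemma outs_mono: "A \<subseteq> B \<Longrightarrow> outs A v \<subseteq> outs B v"
  by (auto simp: outs_def)

lemma outd_mono: "A \<subseteq> B \<Longrightarrow> outd A v \<le> outd B v"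
  by (simp add: card_mono outs_mono)

lemma outs_adj: "outs (set p) v \<subseteq> {u \<in> set p. c u \<noteq> c v}"
  by (auto simp: outs_def dest: arc_colours)

lemma outd_cycle_le:
  assumes "fits l S" "cyc p" "set p \<subseteq> S" "length p = l" "v \<in> S"
  shows "outd (set p) v \<le> 2"
  using fits_adj[OF assms] card_mono[OF _ outs_adj[of p v]] by simp

lemma outd_cycle_full:
  assumes "fits l S" "cyc p" "set p \<subseteq> S" "length p = l" "v \<in> S" "2 \<le> outd (set p) v"
    "u \<in> set p" "c u \<noteq> c v"
  shows "E v u"
proof -
  have "outs (set p) v = {u \<in> set p. c u \<noteq> c v}"
    by (rule card_seteq) (use fits_adj[OF assms(1-5)] assms(6) outs_adj in auto)
  then show ?thesis using assms(7,8) by (auto simp: outs_def)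
qed

lemma outd_remove:
  assumes "fits l S" "cyc p" "set p \<subseteq> S" "length p = l" "v \<in> S"
  shows "outd S v \<le> outd (S - set p) v + 2"
proof -
  have "outs S v = outs (S - set p) v \<union> outs (set p) v" using assms(3) by (auto simp: outs_def)
  then have "outd S v \<le> outd (S - set p) v + outd (set p) v" by (metis card_Un_le)
  then show ?thesis using outd_cycle_le[OF assms] by simp
qed

definition joined :: "'a set \<Rightarrow> 'a set \<Rightarrow> bool" where
  "joined A B \<longleftrightarrow> (\<forall>u\<in>A. \<forall>v\<in>B. c u \<noteq> c v \<longrightarrow> E u v)"

lemma joinedD: "joined A B \<Longrightarrow> u \<in> A \<Longrightarrow> v \<in> B \<Longrightarrow> c u \<noteq> c v \<Longrightarrow> E u v"
  by (simp add: joined_def)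

text \<open>A 4-cycle can be entered at a vertex of either colour.\<close>
lemma cyc4_coloured:
  assumes "cyc p" "length p = 4" "set p \<subseteq> S" "S \<subseteq> V" "card (c ` S) \<le> 2" "u \<in> S" "v \<in> S" "c u \<noteq> c v"
  shows "\<exists>x y z w. set p = {x, y, z, w} \<and> distinct [x, y, z, w] \<and> E x y \<and> E y z \<and> E z w \<and> E w x \<and> c x = c u \<and> c y = c v \<and> c z = c u \<and> c w = c v"
proof -
  obtain x y z w where p: "p = [x, y, z, w]" "E x y" "E y z" "E z w" "E w x" using cyc4E assms by metis
  note ar = arc_colours[OF p(2)] arc_colours[OF p(3)] arc_colours[OF p(4)] arc_colours[OF p(5)]
  have S: "x \<in> S" "y \<in> S" "z \<in> S" "w \<in> S" "S \<subseteq> V" using assms p(1) by auto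
  have two: "c t = c u \<or> c t = c v" if "t \<in> S" for t using two_colours_eq[of S u v t] that assms by auto
  have d: "distinct [x, y, z, w]" using assms(1) p(1) by (auto simp: cyc_def)
  from two[OF S(1)] show ?thesis
  proof
    assume "c x = c u"
    moreover from this have "c y = c v" "c w = c v" using two[OF S(2)] two[OF S(4)] ar by auto
    moreover from this have "c z = c u" using two[OF S(3)] ar by auto
    ultimately show ?thesis using p d by (intro exI[of _ x] exI[of _ y] exI[of _ z] exI[of _ w]) auto
  next
    assume "c x = c v"
    moreover from this have "c y = c u" "c w = c u" using two[OF S(2)] two[OF S(4)] ar by auto
    moreover from this have "c z = c v" using two[OF S(3)] ar by auto
    ultimately show ?thesis using p d by (intro exI[of _ y] exI[of _ z] exI[of _ w] exI[of _ x]) auto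
  qed
qed

lemma cyc3_coloured:
  assumes "cyc p" "length p = 3" "set p \<subseteq> S" "S \<subseteq> V" "card (c ` S) \<le> 3" "u \<in> S" "v \<in> S" "w \<in> S"
    "c u \<noteq> c v" "c v \<noteq> c w" "c w \<noteq> c u"
  shows "\<exists>x y z. {x, y, z} \<subseteq> set p \<and> c x = c u \<and> c y = c v \<and> c z = c w"
proof -
  obtain x y z where p: "p = [x, y, z]" "E x y" "E y z" "E z x" using cyc3E assms by metis
  note ar = arc_colours[OF p(2)] arc_colours[OF p(3)] arc_colours[OF p(4)]
  have "c ` set p = {c u, c v, c w}"
  proof (rule card_subset_eq)
    show "c ` set p \<subseteq> {c u, c v, c w}"
      using three_colours_eq[of S u v w] assms by blast
    show "card (c ` set p) = card {c u, c v, c w}" using p(1) ar assms(9-11) by auto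
  qed simp
  then have "c u \<in> c ` set p" "c v \<in> c ` set p" "c w \<in> c ` set p" by auto
  then obtain x y z where "x \<in> set p" "c x = c u" "y \<in> set p" "c y = c v" "z \<in> set p" "c z = c w"
    by (elim imageE) metis
  then show ?thesis by blast
qed

text \<open>
  If \<open>p\<close>, \<open>q\<close> and \<open>r\<close> dominate each other cyclically, then short paths in them can be linked
  to two disjoint cycles of different lengths: 3 and 4 if \<open>l = 3\<close>, and 4 and 6 if \<open>l = 4\<close>.
\<close>
lemma three_joined_cycles:
  assumes fit: "fits l S" and hom: "uniform S 2"
    and p: "cyc p" "set p \<subseteq> S" "length p = l"
    and q: "cyc q" "set q \<subseteq> S" "length q = l"
    and r: "cyc r" "set r \<subseteq> S" "length r = l"
    and dis: "set p \<inter> set q = {}" "set q \<inter> set r = {}" "set r \<inter> set p = {}"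
    and jn: "joined (set p) (set q)" "joined (set q) (set r)" "joined (set r) (set p)"
  shows False
proof -
  have SV: "S \<subseteq> V" using fit by (simp add: fits_def)
  consider "l = 3" "card (c ` S) \<le> 3" | "l = 4" "card (c ` S) \<le> 2" using fit by (auto simp: fits_def)
  then show False
  proof cases
    case 1
    obtain a0 a1 a2 where a: "p = [a0, a1, a2]" "E a0 a1" "E a1 a2" "E a2 a0" using cyc3E p 1 by metis
    have S: "a0 \<in> S" "a1 \<in> S" "a2 \<in> S" using a(1) p by auto
    note ar = arc_colours[OF a(2)] arc_colours[OF a(3)] arc_colours[OF a(4)]
    obtain c0 c1 c2 where cc: "{c0, c1, c2} \<subseteq> set q" "c c0 = c a0" "c c1 = c a1" "c c2 = c a2"
      using cyc3_coloured[OF q(1) _ q(2) SV 1(2) S ar] q(3) 1 by blast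
    obtain b0 b1 b2 where bb: "{b0, b1, b2} \<subseteq> set r" "c b0 = c a0" "c b1 = c a1" "c b2 = c a2"
      using cyc3_coloured[OF r(1) _ r(2) SV 1(2) S ar] r(3) 1 by blast
    have pq: "E a2 c0" "E a0 c2" by (rule joinedD[OF jn(1)]; use cc a(1) ar in simp)+
    have qr: "E c0 b2" "E c2 b1" by (rule joinedD[OF jn(2)]; use cc bb ar in simp)+
    have rp: "E b2 a1" "E b1 a0" by (rule joinedD[OF jn(3)]; use bb a(1) ar in simp)+
    note arcs = pq qr rp
    have in1: "{a0, a1, a2} \<subseteq> set p" using a by auto
    have "distinct [a1, a2, c0, b2]" "distinct [a0, c2, b1]" "set [a1, a2, c0, b2] \<inter> set [a0, c2, b1] = {}"
      using in1 cc bb dis ar by auto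
    then have "cyc [a1, a2, c0, b2]" "cyc [a0, c2, b1]" "set [a1, a2, c0, b2] \<inter> set [a0, c2, b1] = {}"
      using arcs a by (auto simp: cyc_iff)
    moreover have "set [a1, a2, c0, b2] \<subseteq> S" "set [a0, c2, b1] \<subseteq> S" using a(1) cc bb p q r by auto
    ultimately show False using uniform_two[OF hom] by fastforce
  next
    case 2
    obtain u v where uv: "u \<in> S" "v \<in> S" "c u \<noteq> c v"
      using p 2 cyc4E[of p] arc_colours by (metis list.set_intros(1,2) subsetD)
    note cc = cyc4_coloured[OF _ _ _ SV 2(2) uv]
    obtain a0 a1 a2 a3 where a: "set p = {a0,a1,a2,a3}" "distinct [a0,a1,a2,a3]" "E a0 a1" "E a1 a2" "E a2 a3" "E a3 a0"
      "c a0 = c u" "c a1 = c v" "c a2 = c u" "c a3 = c v"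
      using cc[OF p(1) _ p(2)] p(3) 2 by blast
    obtain d0 d1 d2 d3 where d: "set q = {d0,d1,d2,d3}" "distinct [d0,d1,d2,d3]" "E d0 d1" "E d1 d2" "E d2 d3" "E d3 d0"
      "c d0 = c u" "c d1 = c v" "c d2 = c u" "c d3 = c v"
      using cc[OF q(1) _ q(2)] q(3) 2 by blast
    obtain b0 b1 b2 b3 where b: "set r = {b0,b1,b2,b3}" "distinct [b0,b1,b2,b3]" "E b0 b1" "E b1 b2" "E b2 b3" "E b3 b0"
      "c b0 = c u" "c b1 = c v" "c b2 = c u" "c b3 = c v"
      using cc[OF r(1) _ r(2)] r(3) 2 by blast
    have pq: "E a1 d0" "E a3 d2" by (rule joinedD[OF jn(1)]; use a d uv(3) in simp)+
    have qr: "E d1 b0" "E d2 b1" by (rule joinedD[OF jn(2)]; use b d uv(3) in simp)+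
    have rp: "E b0 a1" "E b3 a2" by (rule joinedD[OF jn(3)]; use a b uv(3) in simp)+
    note arcs = pq qr rp
    have dd: "distinct [b0, a1, d0, d1]" "distinct [b1, b2, b3, a2, a3, d2]"
      "set [b0, a1, d0, d1] \<inter> set [b1, b2, b3, a2, a3, d2] = {}"
      using a(1,2) b(1,2) d(1,2) dis by auto
    then have "cyc [b0, a1, d0, d1]" "cyc [b1, b2, b3, a2, a3, d2]"
      using arcs a(3-6) b(3-6) d(3-6) by (auto simp: cyc_iff)
    moreover have "set [b0, a1, d0, d1] \<subseteq> S" "set [b1, b2, b3, a2, a3, d2] \<subseteq> S" using a(1) b(1) d(1) p q r by auto
    ultimately show False using uniform_two[OF hom _ _ _ _ dd(3)] by fastforce
  qed
qed

section \<open>Two disjoint cycles in a strong digraph\<close>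

lemma outd_le1I:
  assumes "\<And>x y. x \<in> K \<Longrightarrow> y \<in> K \<Longrightarrow> E v x \<Longrightarrow> E v y \<Longrightarrow> x = y"
  shows "outd K v \<le> 1"
  using assms by (auto simp: outs_def card_le_Suc0_iff_eq[OF finite_outs, unfolded outs_def])

lemma levels_outd_le1:
  assumes "levels K l f" "v \<in> K" "cyc q" "set q \<subseteq> K" "length q = l"
    "\<And>x. x \<in> K \<Longrightarrow> E v x \<Longrightarrow> x \<in> set q"
  shows "outd K v \<le> 1"
proof (rule outd_le1I)
  fix x y assume xy: "x \<in> K" "y \<in> K" "E v x" "E v y"
  then have "f x = f y" using assms(1,2) unfolding levels_def by metis
  then show "x = y" using cyc_level[OF assms(1,3,4,5)] assms(6) xy by blast
qed

lemma cyc_all_levels: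
  assumes "levels K l f" "cyc p" "set p \<subseteq> K" "length p = l" "i < l"
  shows "\<exists>a\<in>set p. f a = i"
proof -
  have "inj_on f (set p)" using cyc_level[OF assms(1-4)] by (auto intro: inj_onI)
  then have "card (f ` set p) = l" using assms(2,4) by (simp add: card_image distinct_card cyc_def)
  moreover have "f ` set p \<subseteq> {..<l}" using assms(1,3) by (auto simp: levels_def)
  ultimately have "f ` set p = {..<l}" by (intro card_subset_eq) auto
  then show ?thesis using assms(5) by (metis imageE lessThan_iff)
qed

text \<open>
  An \<open>l\<close>-cycle visits the level just before the one that consists of \<open>w\<close> alone, and there its vertex has \<open>w\<close> as its
  only out-neighbour.
\<close>
lemma levels_cycle_low:
  assumes "levels K l f" "cyc p" "set p \<subseteq> K" "length p = l" "w \<in> K" "\<And>u. u \<in> K \<Longrightarrow> f u = f w \<Longrightarrow> u = w"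
  shows "\<exists>a\<in>set p. outd K a \<le> 1"
proof -
  have l: "0 < l" using levels_pos[OF assms(1,5)] .
  have wl: "f w < l" using assms(1,5) by (simp add: levels_def)
  have "(f w + (l - 1)) mod l < l" using l by simp
  then obtain a where a: "a \<in> set p" "f a = (f w + (l - 1)) mod l"
    using cyc_all_levels[OF assms(1-4)] by blast
  have "Suc (f a) mod l = (Suc (f w + (l - 1))) mod l" unfolding a(2) by (simp add: mod_Suc_eq)
  also have "\<dots> = f w" using l wl by simp
  finally have "Suc (f a) mod l = f w" .
  then have "outd K a \<le> 1" using assms(1,3,6) a(1) unfolding levels_def by (intro outd_le1I) (metis subsetD)
  then show ?thesis using a by blast
qed

lemma terminal_outd: "terminal T K \<Longrightarrow> v \<in> K \<Longrightarrow> outd K v = outd T v"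
  using outs_closed unfolding terminal_def by metis

lemma terminal_sub: "terminal T K \<Longrightarrow> K \<subseteq> T" "terminal T K \<Longrightarrow> strong K" "terminal T K \<Longrightarrow> K \<noteq> {}"
  by (auto simp: terminal_def out_closed_def strong_def)

lemma terminalD: "terminal T K \<Longrightarrow> u \<in> K \<Longrightarrow> v \<in> T \<Longrightarrow> E u v \<Longrightarrow> v \<in> K"
  by (auto simp: terminal_def out_closed_def)

lemma outd_posE:
  assumes "0 < outd S v"
  obtains u where "u \<in> S" "E v u"
  using assms by (auto simp: card_gt_0_iff outs_def)

context
  fixes l :: nat and S :: "'a set"
  assumes fit: "fits l S" and hom: "uniform S 2" and deg: "\<And>v. v \<in> S \<Longrightarrow> 3 \<le> outd S v"
begin

lemma S_V: "S \<subseteq> V" using fit by (simp add: fits_def)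

text \<open>
  Cycles in \<open>K\<close> are disjoint from \<open>p\<close>, so uniformity forces them to have the length \<open>l\<close> of \<open>p\<close>.
  In particular none has length \<open>2 * l\<close>, and some level is a singleton, which is numbered 0.
\<close>
lemma complement_structure:
  assumes p: "cyc p" "set p \<subseteq> S" "length p = l" and K: "terminal (S - set p) K"
  shows "\<exists>f. levels K l f \<and> (\<exists>w\<in>K. f w = 0 \<and> (\<forall>u\<in>K. f u = f w \<longrightarrow> u = w))"
proof -
  have KS: "K \<subseteq> S - set p" using K terminal_sub by blast
  have pos: "0 < outd K v" if "v \<in> K" for v
  proof -
    have "v \<in> S" using that KS by blast
    then show ?thesis using outd_remove[OF fit p] deg terminal_outd[OF K that] by fastforce
  qed
  obtain a where a: "a \<in> K" using terminal_sub[OF K] by blast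
  then obtain b where b: "b \<in> K" "E a b" using outd_posE[OF pos] by metis
  have len: "length q = l" if "cyc q" "set q \<subseteq> K" for q
    using uniform_two[OF hom that(1) p(1)] that p(2,3) KS by blast
  have l3: "3 \<le> l" using cyc_ge3 p by blast
  obtain g where g: "levels K l g"
    using levels_exist[OF terminal_sub(2)[OF K] _ b(2) a b(1) len l3] KS S_V by blast
  have "\<not> (\<exists>q. cyc q \<and> set q \<subseteq> K \<and> length q = 2 * l)" using len l3 by fastforce
  then obtain w where w: "w \<in> K" "\<And>u. u \<in> K \<Longrightarrow> g u = g w \<Longrightarrow> u = w" using level_singleton[OF g] l3 by auto
  have gw: "g w < l" using g w by (simp add: levels_def)
  define f where "f v = (g v + (l - g w)) mod l" for v
  have "levels K l f" using levels_shift[OF g gw] unfolding f_def .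
  moreover have "f w = 0" using gw by (simp add: f_def)
  moreover have "u = w" if "u \<in> K" "f u = f w" for u
  proof -
    have "g u mod l = g w mod l" using that(2) unfolding f_def mod_add_cancel_nat .
    moreover have "g u < l" using g that by (simp add: levels_def)
    ultimately show ?thesis using w(2)[OF that(1)] gw by simp
  qed
  ultimately show ?thesis using w(1) by blast
qed

text \<open>
  The out-neighbours of \<open>v\<close>, at least three, lie in \<open>K\<close> or on \<open>p\<close>, and \<open>p\<close> contains only two neighbours of \<open>v\<close>.
\<close>
lemma complement_full:
  assumes p: "cyc p" "set p \<subseteq> S" "length p = l" and K: "terminal (S - set p) K"
    and v: "v \<in> K" "outd K v \<le> 1"
  shows "2 \<le> outd (set p) v" and "u \<in> set p \<Longrightarrow> c u \<noteq> c v \<Longrightarrow> E v u"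
proof -
  have vS: "v \<in> S" using v K terminal_sub by blast
  have "outs S v = outs (S - set p) v \<union> outs (set p) v" using p(2) by (auto simp: outs_def)
  then have "outd S v \<le> outd (S - set p) v + outd (set p) v" by (metis card_Un_le)
  then show 2: "2 \<le> outd (set p) v" using deg[OF vS] terminal_outd[OF K v(1)] v(2) by linarith
  show "u \<in> set p \<Longrightarrow> c u \<noteq> c v \<Longrightarrow> E v u" using outd_cycle_full[OF fit p vS 2] by blast
qed

lemma complement_nonempty:
  assumes p: "cyc p" "set p \<subseteq> S" "length p = l"
  shows "S - set p \<noteq> {}"
proof -
  have "hd p \<in> S" using p by (auto simp: cyc_def)
  then have "0 < outd (S - set p) (hd p)" using outd_remove[OF fit p] deg by fastforce
  then show ?thesis by (auto simp: outs_def card_gt_0_iff)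
qed

lemma levels_transversal:
  assumes "levels K l f" "0 < l"
  shows "\<exists>q. cyc q \<and> set q \<subseteq> K \<and> length q = l"
proof -
  have "\<forall>i. \<exists>u. i < l \<longrightarrow> u \<in> K \<and> f u = i" using assms by (auto simp: levels_def)
  then obtain t where t: "\<And>i. i < l \<Longrightarrow> t i \<in> K \<and> f (t i) = i" by metis
  have "cyc (map t [0..<l])" using transversal_cyc[OF assms] t by blast
  then show ?thesis using t by (intro exI[of _ "map t [0..<l]"]) auto
qed

text \<open>
  The levels of \<open>K\<close> are numbered such that level 0 is the single vertex \<open>w\<close>, which lies on every
  \<open>l\<close>-cycle \<open>q\<close> of \<open>K\<close>.  Hence an arc between vertices of \<open>K\<close> whose head is off \<open>q\<close> always raises the
  level, and a vertex of \<open>K \<inter> K'\<close> of maximal level has no out-neighbour in \<open>K - set q\<close>, because such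
  a vertex would again belong to \<open>K'\<close>.

  If \<open>K'\<close> missed \<open>p\<close>, then \<open>K = set q\<close>, and \<open>q\<close>, \<open>p\<close>, \<open>K'\<close> would dominate each other cyclically,
  which \<open>three_joined_cycles\<close> excludes.  So \<open>K'\<close> contains \<open>p\<close>.  A vertex of \<open>K \<inter> K'\<close> of maximal level
  would have only one out-neighbour in \<open>K\<close>, hence two on \<open>p\<close>, whereas a vertex of the blow-up \<open>K'\<close>
  dominates at most one vertex of the cycle \<open>p\<close> of \<open>K'\<close>.  So \<open>K\<close> and \<open>K'\<close> are disjoint, and their
  union is out-closed.
\<close>
lemma two_terminals:
  assumes strongS: "strong S" and p: "cyc p" "set p \<subseteq> S" "length p = l"
  shows "\<exists>q K K'. cyc q \<and> length q = l \<and> set q \<subseteq> K \<and> set p \<subseteq> K' \<and> S = K \<union> K' \<and> K \<inter> K' = {} \<and>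
    terminal (S - set p) K \<and> terminal (S - set q) K'"
proof -
  have fin: "finite S" using finite_sub[OF S_V] .
  have l0: "0 < l" using p by (auto simp: cyc_def)
  obtain K where K: "terminal (S - set p) K"
    using terminal_exists[of "S - set p"] complement_nonempty[OF p] fin by auto
  obtain f w where f: "levels K l f" and w: "w \<in> K" "f w = 0" "\<And>u. u \<in> K \<Longrightarrow> f u = f w \<Longrightarrow> u = w"
    using complement_structure[OF p K] by blast
  have KS: "K \<subseteq> S - set p" using K terminal_sub by blast
  obtain q where q: "cyc q" "set q \<subseteq> K" "length q = l" using levels_transversal[OF f l0] by blast
  have qS: "set q \<subseteq> S" using q KS by blast
  have wq: "w \<in> set q" using cyc_all_levels[OF f q l0] w q(2) by (metis subsetD)
  obtain K' where K': "terminal (S - set q) K'"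
    using terminal_exists[of "S - set q"] complement_nonempty[OF q(1) qS q(3)] fin by auto
  obtain f' where f': "levels K' l f'" using complement_structure[OF q(1) qS q(3) K'] by blast
  have KS': "K' \<subseteq> S - set q" using K' terminal_sub by blast
  have outK: "v \<in> K \<or> v \<in> set p" if "u \<in> K" "v \<in> S" "E u v" for u v
    using terminalD[OF K that(1) _ that(3)] that(2) by blast
  have outK': "v \<in> K' \<or> v \<in> set q" if "u \<in> K'" "v \<in> S" "E u v" for u v
    using terminalD[OF K' that(1) _ that(3)] that(2) by blast
  have up: "f u = Suc (f v)" if "v \<in> K" "u \<in> K" "E v u" "u \<notin> set q" for u v
  proof -
    have "f u \<noteq> 0" using w wq that by metis
    moreover have "f u = Suc (f v) mod l" "f v < l" using f that by (auto simp: levels_def)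
    ultimately show ?thesis by (auto simp: mod_if split: if_splits)
  qed
  have maximal: "\<exists>v\<in>K \<inter> K'. \<forall>x\<in>K \<inter> K'. f x \<le> f v" if "K \<inter> K' \<noteq> {}"
    using ex_max_on[of "K \<inter> K'" f] that fin KS finite_subset by blast
  have succ_ex: "\<exists>u\<in>K'. E v u" if "v \<in> K'" for v
  proof -
    obtain b where "b \<in> K'" "f' b = Suc (f' v) mod l" using f' l0 unfolding levels_def by (meson mod_less_divisor)
    then show ?thesis using f' that unfolding levels_def by blast
  qed
  have meets: "set p \<inter> K' \<noteq> {}"
  proof
    assume disj: "set p \<inter> K' = {}"
    have KK': "K \<inter> K' = {}"
    proof (rule ccontr)
      assume "K \<inter> K' \<noteq> {}"
      then obtain v where v: "v \<in> K" "v \<in> K'" "\<And>x. x \<in> K \<Longrightarrow> x \<in> K' \<Longrightarrow> f x \<le> f v" using maximal by blast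
      obtain u where u: "u \<in> K'" "E v u" using succ_ex v by blast
      then have "u \<in> K" "u \<notin> set q" using outK v disj KS' by blast+
      then have "f u = Suc (f v)" using up v u by blast
      then show False using v(3)[of u] u(1) \<open>u \<in> K\<close> by simp
    qed
    have down: "E r u \<and> u \<in> set q" if "r \<in> K'" "u \<in> K" "c r \<noteq> c u" for r u
    proof -
      have "\<not> E u r" using outK that disj KS' KK' by blast
      then have "E r u" using arc_total[of r u] that KS KS' S_V by blast
      then show ?thesis using outK'[of r u] that KS KK' by blast
    qed
    have Kq: "K = set q"
    proof
      show "K \<subseteq> set q"
      proof
        fix u assume u: "u \<in> K"
        obtain a b where "a \<in> K'" "b \<in> K'" "E a b" using succ_ex terminal_sub(3)[OF K'] by blast
        then obtain r where "r \<in> K'" "c r \<noteq> c u" using arc_colours by metis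
        then show "u \<in> set q" using down u by blast
      qed
    qed (rule q(2))
    have "joined (set q) (set p)" unfolding joined_def
    proof (intro ballI impI)
      fix u v assume uv: "u \<in> set q" "v \<in> set p" "c u \<noteq> c v"
      have "outd K u \<le> 1" using levels_outd_le1[OF f _ q] uv(1) Kq by blast
      then show "E u v" using complement_full(2)[OF p K] uv Kq by metis
    qed
    obtain q' where q': "cyc q'" "set q' \<subseteq> K'" "length q' = l" using levels_transversal[OF f' l0] by blast
    have "joined (set p) (set q')" unfolding joined_def
    proof (intro ballI impI)
      fix u v assume uv: "u \<in> set p" "v \<in> set q'" "c u \<noteq> c v"
      have vK: "v \<in> K'" and uS: "u \<in> S" using uv q'(2) p(2) by auto
      have "u \<notin> K'" "u \<notin> set q" using uv(1) disj q(2) KS by auto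
      then have "\<not> E v u" using outK'[OF vK uS] by blast
      moreover have "u \<in> V" "v \<in> V" using uS vK KS' S_V by auto
      ultimately show "E u v" using arc_total uv(3) by blast
    qed
    moreover have "joined (set q') (set q)" unfolding joined_def using down q' Kq by blast
    moreover note \<open>joined (set q) (set p)\<close>
    moreover have "set q' \<subseteq> S" "set p \<inter> set q' = {}" "set q' \<inter> set q = {}" "set q \<inter> set p = {}"
      using q'(2) q(2) KS KS' disj by auto
    ultimately show False
      using three_joined_cycles[OF fit hom p q'(1) _ q'(3) q(1) qS q(3)] by blast
  qed
  have pK': "set p \<subseteq> K'"
    using cyc_closed[OF p(1), of "S - set q" K'] p(2) q(2) KS K' meets by (auto simp: terminal_def)
  have KK': "K \<inter> K' = {}"
  proof (rule ccontr)
    assume "K \<inter> K' \<noteq> {}"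
    then obtain v where v: "v \<in> K" "v \<in> K'" "\<And>x. x \<in> K \<Longrightarrow> x \<in> K' \<Longrightarrow> f x \<le> f v" using maximal by blast
    have "x \<in> set q" if x: "x \<in> K" "E v x" for x
    proof (rule ccontr)
      assume xq: "x \<notin> set q"
      then have "x \<in> K'" using outK'[OF v(2) _ x(2)] x KS by blast
      moreover have "f x = Suc (f v)" using up v x xq by blast
      ultimately show False using v(3) x by fastforce
    qed
    then have "outd K v \<le> 1" using levels_outd_le1[OF f v(1) q] by blast
    then have "2 \<le> outd (set p) v" using complement_full(1)[OF p K v(1)] by blast
    moreover have "outd (set p) v \<le> 1"
    proof (rule outd_le1I)
      fix x y assume xy: "x \<in> set p" "y \<in> set p" "E v x" "E v y"
      then have "x \<in> K'" "y \<in> K'" using pK' by auto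
      then have "f' x = f' y" using f' v(2) xy unfolding levels_def by metis
      then show "x = y" using cyc_level[OF f' p(1) pK' p(3)] xy by blast
    qed
    ultimately show False by simp
  qed
  have "out_closed S (K \<union> K')" unfolding out_closed_def using outK outK' pK' q(2) KS KS' by blast
  then have "S = K \<union> K'" using strongS terminal_sub(3)[OF K] unfolding strong_def by blast
  then show ?thesis using q pK' KK' K K' by blast
qed

text \<open>
  If \<open>K\<close> were just the cycle \<open>q\<close>, every vertex of \<open>q\<close> would dominate its neighbours on \<open>p\<close>.  Then
  all out-neighbours of a vertex of \<open>p\<close> lie in \<open>K'\<close>, although the vertex of \<open>p\<close> preceding the singleton level has
  only one there.
\<close>
lemma side_not_cycle:
  assumes p: "cyc p" "set p \<subseteq> S" "length p = l" and q: "cyc q" "set q \<subseteq> S" "length q = l"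
    and S: "S = set q \<union> K'" "set q \<inter> K' = {}" "set p \<subseteq> K'"
    and K: "terminal (S - set p) (set q)" and K': "terminal (S - set q) K'"
  shows False
proof -
  obtain f where f: "levels (set q) l f" using complement_structure[OF p K] by blast
  obtain f' w where f': "levels K' l f'" and w: "w \<in> K'" "\<And>u. u \<in> K' \<Longrightarrow> f' u = f' w \<Longrightarrow> u = w"
    using complement_structure[OF q K'] by blast
  obtain a where a: "a \<in> set p" "outd K' a \<le> 1" using levels_cycle_low[OF f' p(1) S(3) p(3) w] by blast
  have disj: "\<not> E a u" if u: "u \<in> set q" for u
  proof
    assume "E a u"
    moreover have "outd (set q) u \<le> 1" using levels_outd_le1[OF f u q(1) _ q(3)] by blast
    then have "c a \<noteq> c u \<Longrightarrow> E u a" using complement_full(2)[OF p K u] a by blast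
    ultimately show False using arc_asym arc_colours by blast
  qed
  then have "outs S a = outs K' a" using S by (auto simp: outs_def)
  then show False using deg[of a] a p(2) by fastforce
qed

text \<open>
  Vertices \<open>r\<close> of \<open>K'\<close> off \<open>p\<close> and \<open>u\<close> of \<open>K\<close> off \<open>q\<close> cannot be adjacent: an arc in either direction would leave
  one of the terminal components.  Both kinds of vertices exist by the previous lemma, so they all have the same
  colour, and the vertices of other colours lie on \<open>p\<close> or \<open>q\<close>, two on each.
\<close>
lemma small_colour_class:
  assumes strongS: "strong S" and p: "cyc p" "set p \<subseteq> S" "length p = l"
  shows "l = 4 \<and> (\<exists>z\<in>S. card {v \<in> S. c v = c z} = 4)"
proof -
  obtain q K K' where q: "cyc q" "length q = l" "set q \<subseteq> K" and pK': "set p \<subseteq> K'" and S: "S = K \<union> K'" "K \<inter> K' = {}"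
    and K: "terminal (S - set p) K" and K': "terminal (S - set q) K'"
    using two_terminals[OF strongS p] by blast
  have qS: "set q \<subseteq> S" using q S by blast
  obtain f where f: "levels K l f" using complement_structure[OF p K] by blast
  obtain f' where f': "levels K' l f'" using complement_structure[OF q(1) qS q(2) K'] by blast
  have cross: "c r = c u" if "r \<in> K' - set p" "u \<in> K - set q" for r u
  proof (rule ccontr)
    assume "c r \<noteq> c u"
    then have "E r u \<or> E u r" using arc_total[of r u] that S S_V by blast
    then show False using terminalD[OF K, of u r] terminalD[OF K', of r u] that S by blast
  qed
  have "K \<noteq> set q" using side_not_cycle[OF p q(1) qS q(2) _ _ pK'] S K K' by blast
  then obtain u where u: "u \<in> K" "u \<notin> set q" using q by blast
  have "K' \<noteq> set p" using side_not_cycle[OF q(1) qS q(2) p _ _ q(3)] S K K' by blast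
  then obtain r where r: "r \<in> K'" "r \<notin> set p" using pK' by blast
  have ru: "c r = c u" using cross r u by blast
  have colK: "c x = c u" if "x \<in> K" "x \<notin> set q" for x using cross[of r x] r that ru by simp
  have colK': "c x = c u" if "x \<in> K'" "x \<notin> set p" for x using cross[of x u] u that by simp
  have uS: "u \<in> S" using u S by blast
  have cp: "card {x \<in> set p. c x \<noteq> c u} = 2" using fits_adj[OF fit p uS] .
  have cq: "card {x \<in> set q. c x \<noteq> c u} = 2" using fits_adj[OF fit q(1) qS q(2) uS] .
  consider "l = 3" | "l = 4" "card (c ` S) \<le> 2" using fit by (auto simp: fits_def)
  then show ?thesis
  proof cases
    case 1
    have "card (set p) = 3" "card (set q) = 3" using p q 1 by (auto simp: cyc_def distinct_card)
    then have "card {x \<in> set p. c x \<noteq> c u} \<noteq> card (set p)" "card {x \<in> set q. c x \<noteq> c u} \<noteq> card (set q)"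
      unfolding cp cq by simp_all
    then have "{x \<in> set p. c x \<noteq> c u} \<noteq> set p" "{x \<in> set q. c x \<noteq> c u} \<noteq> set q" by metis+
    then obtain g g' where g: "g \<in> set q" "c g = c u" and g': "g' \<in> set p" "c g' = c u" by blast
    obtain x1 x2 x3 where "p = [x1, x2, x3]" "E x1 x2" "E x2 x3" "E x3 x1"
      using cyc3E[OF p(1)] p(3) 1 by metis
    then obtain s where s: "s \<in> set p" "E g' s" using g'(1) by auto
    have cs: "c s \<noteq> c u" using arc_colours s g' by metis
    have "x \<in> set q" if "x \<in> K" "E g x" for x using colK[of x] arc_colours that g by metis
    then have "outd K g \<le> 1" using levels_outd_le1[OF f _ q(1,3,2)] g q(3) by blast
    (* g and s have only one out-neighbour in K and K', so each of them would dominate the other. *)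
    then have "E g s" using complement_full(2)[OF p K] g q(3) s cs by (metis subsetD)
    moreover have "x \<in> set p" if x: "x \<in> K'" "E s x" for x
    proof (rule ccontr)
      assume "x \<notin> set p"
      then have "c x = c g'" using colK' x g' by simp
      have K3: "g' \<in> K'" "s \<in> K'" using g' s pK' by auto
      (* Three steps from g' return to its level, so x, two steps away, dominates g'. *)
      have lg: "f' g' < 3" using f' K3 1 by (simp add: levels_def)
      have "f' s = Suc (f' g') mod 3" "f' x = Suc (f' s) mod 3" using f' K3 x s(2) 1 unfolding levels_def by blast+
      then have "f' g' = Suc (f' x) mod 3" using lg by (auto simp: mod_Suc mod_if split: if_splits)
      then have "E x g'" using f' K3 x 1 unfolding levels_def by blast
      then show False using arc_colours \<open>c x = c g'\<close> by blast
    qed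
    then have "outd K' s \<le> 1" using levels_outd_le1[OF f' _ p(1) pK' p(3)] s pK' by blast
    then have "E s g" using complement_full(2)[OF q(1) qS q(2) K'] g s pK' cs by (metis subsetD)
    ultimately show ?thesis using arc_asym by blast
  next
    case 2
    have "{x \<in> set p. c x \<noteq> c u} \<noteq> {}" using cp by (metis card.empty zero_neq_numeral)
    then obtain z where z: "z \<in> set p" "c z \<noteq> c u" by blast
    have zS: "z \<in> S" using z p by blast
    have "c v = c z \<longleftrightarrow> c v \<noteq> c u" if "v \<in> S" for v
      using two_colours_eq[OF S_V 2(2) uS zS that] z by auto
    then have "{v \<in> S. c v = c z} = {x \<in> set p. c x \<noteq> c u} \<union> {x \<in> set q. c x \<noteq> c u}"
      using colK colK' S p qS by blast
    moreover have "{x \<in> set p. c x \<noteq> c u} \<inter> {x \<in> set q. c x \<noteq> c u} = {}" using pK' q S by blast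
    ultimately have "card {v \<in> S. c v = c z} = 4" using cp cq by (simp add: card_Un_disjoint)
    then show ?thesis using 2 zS by blast
  qed
qed

end

lemma fits4_not_triangle: "fits 4 S \<Longrightarrow> cyc p \<Longrightarrow> set p \<subseteq> S \<Longrightarrow> length p \<noteq> 3"
proof
  assume S: "fits 4 S" and p: "cyc p" "set p \<subseteq> S" "length p = 3"
  obtain x y z where e: "p = [x, y, z]" "E x y" "E y z" "E z x" using cyc3E p by metis
  have "c z = c x \<or> c z = c y"
    using two_colours_eq[of S x y z] S p(2) e(1) arc_colours[OF e(2)] by (auto simp: fits_def)
  then show False using arc_colours[OF e(3)] arc_colours[OF e(4)] by auto
qed

lemma fits4_cycle:
  assumes "fits 4 S" "S \<noteq> {}" "\<And>v. v \<in> S \<Longrightarrow> 0 < outd S v"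
  shows "\<exists>p. cyc p \<and> set p \<subseteq> S \<and> length p = 4"
  using short_cyc_outd[OF _ assms(2,3)] fits4_not_triangle[OF assms(1)] finite_sub[of S] assms(1)
  unfolding fits_def by metis

section \<open>Minimum out-degree and disjoint cycles\<close>

text \<open>
  If there is no triangle, the terminal component is bipartite, and the set \<open>T\<close> must be taken inside this component for the
  removal of a 4-cycle to cost no more than two out-neighbours.
\<close>
lemma removable_cycle:
  assumes S: "fits 3 S" "S \<noteq> {}" and deg: "\<And>v. v \<in> S \<Longrightarrow> 0 < outd S v"
  shows "\<exists>p T. cyc p \<and> set p \<subseteq> S \<and> T \<subseteq> S - set p \<and> (\<forall>v\<in>T \<union> set p. outd S v \<le> outd T v + 2)"
proof (cases "\<exists>p. cyc p \<and> set p \<subseteq> S \<and> length p = 3")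
  case True
  then obtain p where p: "cyc p" "set p \<subseteq> S" "length p = 3" by blast
  then show ?thesis using outd_remove[OF S(1) p] by (intro exI[of _ p] exI[of _ "S - set p"]) blast
next
  case False
  have SV: "S \<subseteq> V" using S by (simp add: fits_def)
  obtain K where K: "terminal S K" using terminal_exists[OF finite_sub[OF SV] S(2)] by blast
  note KS = terminal_sub(1)[OF K]
  have "card (c ` K) \<le> 3" using fits_mono[OF S(1) KS] by (simp add: fits_def)
  then have "card (c ` K) \<le> 2"
    using triangle_free_bipartite[OF _ terminal_sub(2)[OF K]] False KS SV by blast
  then have fit: "fits 4 K" using KS SV by (simp add: fits_def)
  obtain p where p: "cyc p" "set p \<subseteq> K" "length p = 4"
    using fits4_cycle[OF fit terminal_sub(3)[OF K]] terminal_outd[OF K] deg KS by (metis subsetD)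
  have "outd S v \<le> outd (K - set p) v + 2" if "v \<in> (K - set p) \<union> set p" for v
  proof -
    have "v \<in> K" using that p by blast
    then show ?thesis using outd_remove[OF fit p] terminal_outd[OF K] by metis
  qed
  then show ?thesis using p KS by (intro exI[of _ p] exI[of _ "K - set p"]) blast
qed

lemma packing_exists:
  assumes "fits 3 S" "0 < k \<Longrightarrow> S \<noteq> {}" "\<And>v. v \<in> S \<Longrightarrow> 2 * k - 1 \<le> outd S v"
  shows "\<exists>F. packing S k F"
  using assms
proof (induction k arbitrary: S)
  case 0
  show ?case by (rule exI[of _ "{}"]) (simp add: packing_def)
next
  case (Suc k)
  have "0 < outd S v" if "v \<in> S" for v using Suc.prems(3)[OF that] by simp
  then obtain p T where p: "cyc p" "set p \<subseteq> S" "T \<subseteq> S - set p" "\<And>v. v \<in> T \<union> set p \<Longrightarrow> outd S v \<le> outd T v + 2"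
    using removable_cycle[OF Suc.prems(1)] Suc.prems(2) by blast
  have T: "2 * k - 1 \<le> outd T v" if "v \<in> T \<union> set p" for v
  proof -
    have "v \<in> S" using that p by blast
    then show ?thesis using p(4)[OF that] Suc.prems(3)[of v] by simp
  qed
  have "T \<noteq> {}" if "0 < k"
  proof -
    have "hd p \<in> T \<union> set p" using p(1) by (simp add: cyc_def)
    then have "0 < outd T (hd p)" using T[of "hd p"] that by linarith
    then show ?thesis by (auto elim: outd_posE)
  qed
  then obtain F where "packing T k F" using Suc.IH[of T] T fits_mono[OF Suc.prems(1), of T] p(3) by blast
  then show ?case using packing_insert p(1-3) by blast
qed

text \<open>
  Removing a triangle leaves a packing of \<open>k - 1\<close> cycles, which by uniformity are
  triangles again; so the claim descends to \<open>k = 2\<close>.  There the terminal component either contains a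
  triangle, which \<open>small_colour_class\<close> excludes, or a 4-cycle disjoint from the given triangle.
\<close>
lemma uniform_no_triangle:
  assumes "2 \<le> k" "fits 3 S" "\<And>v. v \<in> S \<Longrightarrow> 2 * k - 1 \<le> outd S v" "uniform S k"
    "cyc p" "set p \<subseteq> S"
  shows "length p \<noteq> 3"
  using assms
proof (induction k arbitrary: S p rule: nat_induct_at_least)
  case base
  have SV: "S \<subseteq> V" using base by (simp add: fits_def)
  have "S \<noteq> {}" using base(4,5) by (auto simp: cyc_def)
  then obtain K where K: "terminal S K" using terminal_exists[OF finite_sub[OF SV]] by blast
  note KS = terminal_sub(1)[OF K]
  have deg: "3 \<le> outd K v" if "v \<in> K" for v using terminal_outd[OF K that] base(2)[of v] that KS by auto
  have hom: "uniform K 2" using uniform_mono base(3) KS by blast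
  have tri: "length q \<noteq> 3" if "cyc q" "set q \<subseteq> K" for q
    using small_colour_class[OF fits_mono[OF base(1) KS] hom deg terminal_sub(2)[OF K] that] by auto
  have "0 < outd K v" if "v \<in> K" for v using deg[OF that] by simp
  then obtain q where q: "cyc q" "set q \<subseteq> K" "length q = 4"
    using short_cyc_outd[OF finite_subset[OF KS finite_sub[OF SV]] terminal_sub(3)[OF K]] tri by metis
  show ?case
  proof
    assume "length p = 3"
    moreover from this have "set p \<inter> K = {}"
      using cyc_closed[OF base(4,5)] K tri base(4) unfolding terminal_def by blast
    ultimately show False using uniform_two[OF base(3,4) q(1) base(5)] q KS by fastforce
  qed
next
  case (Suc k)
  show ?case
  proof
    assume l: "length p = 3"
    let ?T = "S - set p"
    have fT: "fits 3 ?T" using fits_mono Suc.prems(1) by blast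
    have deg: "2 * k - 1 \<le> outd ?T v" if "v \<in> S" for v
      using outd_remove[OF Suc.prems(1,4,5) l that] Suc.prems(2)[OF that] by simp
    have hom: "uniform ?T k" using uniform_remove Suc.prems(3,4,5) by blast
    have "hd p \<in> S" using Suc.prems(4,5) by (auto simp: cyc_def)
    then have "0 < outd ?T (hd p)" using deg[of "hd p"] Suc.hyps by linarith
    then have "?T \<noteq> {}" by (auto elim: outd_posE)
    then obtain F where F: "packing ?T k F" using packing_exists[OF fT] deg by blast
    then have "F \<noteq> {}" using Suc.hyps by (auto simp: packing_def)
    then obtain q where q: "q \<in> F" by blast
    have "length q = 3" using uniform_same[OF Suc.prems(3,4,5) F q] l by simp
    moreover have "cyc q" "set q \<subseteq> ?T" using F q unfolding packing_def by blast+
    ultimately show False using Suc.IH[OF fT _ hom] deg by blast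
  qed
qed

section \<open>The colour class with 2k vertices\<close>

text \<open>
  The vertex \<open>x\<close> has an in-neighbour in \<open>Y\<close>, so its at least \<open>m\<close> out-neighbours exhaust the rest of \<open>Y\<close>.
  This is what gives a small colour class the structure of \<open>BT\<close>.
\<close>
lemma unique_in_neighbour:
  assumes K: "strong K" "fits 4 K" and z: "z \<in> K" and Y: "Y = {v \<in> K. c v = c z}" "card Y \<le> Suc m"
    and deg: "\<And>v. v \<in> K \<Longrightarrow> m \<le> outd K v" and x: "x \<in> K" "c x \<noteq> c z"
  shows "\<exists>y\<in>Y. E y x \<and> (\<forall>y'\<in>Y - {y}. E x y') \<and> outd K x \<le> m"
proof -
  have KV: "K \<subseteq> V" "card (c ` K) \<le> 2" using K by (auto simp: fits_def)
  have finY: "finite Y" using finite_sub[OF KV(1)] Y by simp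
  have other: "c v = c z" if "v \<in> K" "c v \<noteq> c x" for v using two_colours_eq[OF KV x(1) z that(1)] x(2) that(2) by auto
  have "\<exists>a\<in>K. \<exists>b\<in>K. E a b" using arc_total[of x z] x z KV(1) by fastforce
  then obtain y where y: "y \<in> K" "E y x" using strong_in[OF K(1) _ _ _ x(1)] by blast
  have yY: "y \<in> Y" using other[OF y(1)] arc_colours[OF y(2)] y Y by simp
  have sub: "outs K x \<subseteq> Y - {y}"
    unfolding outs_def Y(1) using other arc_colours arc_asym y(2) by fastforce
  have cY: "card (Y - {y}) \<le> m" using Y(2) yY finY by simp
  have "outs K x = Y - {y}" using card_seteq[OF _ sub] finY cY deg[OF x(1)] by simp
  moreover from this have "outd K x \<le> m" using cY by simp
  ultimately show ?thesis using y(2) yY by (auto simp: outs_def)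
qed

lemma escape_cycle:
  assumes "fits l S" "cyc q" "set q \<subseteq> S" "length q = l" "v \<in> S" "3 \<le> outd K v"
  shows "\<exists>x\<in>K - set q. E v x"
proof (rule ccontr)
  assume "\<not> ?thesis"
  then have "outs K v \<subseteq> outs (set q) v" by (auto simp: outs_def)
  then have "outd K v \<le> outd (set q) v" by (simp add: card_mono)
  then show False using outd_cycle_le[OF assms(1-5)] assms(6) by simp
qed

lemma outd_remove_terminal:
  assumes "fits l S" "cyc p" "set p \<subseteq> S" "length p = l" "terminal (S - set p) K" "v \<in> K"
  shows "outd S v \<le> outd K v + 2"
  using outd_remove[OF assms(1-4), of v] terminal_outd[OF assms(5,6)] terminal_sub(1)[OF assms(5)] assms(6) by auto

text \<open>
  For the induction step, let \<open>K\<close> be a terminal component after the removal of a 4-cycle \<open>p\<close>, with its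
  colour class \<open>Y\<close> of size \<open>2k\<close>, and \<open>K'\<close> one after the removal of a 4-cycle \<open>q\<close> of \<open>K\<close>.
  Vertices of \<open>K\<close> outside \<open>Y\<close> have at most \<open>2k - 1\<close> out-neighbours in \<open>K\<close>, so they dominate both
  vertices \<open>Yp\<close> of \<open>p\<close> that have the colour of \<open>Y\<close>.  It follows that \<open>K'\<close> contains \<open>Yp\<close> and
  \<open>Y - set q\<close>, which are \<open>2k\<close> vertices.  The class of size \<open>2k\<close> in \<open>K'\<close> must have the same
  colour and thus consists of just these vertices, and since \<open>S = K \<union> K'\<close>, the class in \<open>S\<close> is
  \<open>Y \<union> Yp\<close>.
\<close>
lemma uniform_colour_class:
  assumes "2 \<le> k" "fits 4 S" "strong S" "\<And>v. v \<in> S \<Longrightarrow> 2 * k - 1 \<le> outd S v" "uniform S k"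
  shows "\<exists>z\<in>S. card {v \<in> S. c v = c z} = 2 * k"
  using assms
proof (induction k arbitrary: S rule: nat_induct_at_least)
  case base
  have deg: "3 \<le> outd S v" if "v \<in> S" for v using base(3)[OF that] by simp
  have pos: "0 < outd S v" if "v \<in> S" for v using deg[OF that] by simp
  have "S \<noteq> {}" using base(2) by (simp add: strong_def)
  then obtain p where p: "cyc p" "set p \<subseteq> S" "length p = 4" using fits4_cycle[OF base(1) _ pos] by blast
  show ?case using small_colour_class[OF base(1,4) deg base(2) p] by auto
next
  case (Suc k)
  note fit = Suc.prems(1)
  have SV: "S \<subseteq> V" "card (c ` S) \<le> 2" using fit by (auto simp: fits_def)
  have fin: "finite S" using finite_sub[OF SV(1)] .
  have pos: "0 < outd S v" if "v \<in> S" for v using Suc.prems(3)[OF that] by simp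
  have "S \<noteq> {}" using Suc.prems(2) by (simp add: strong_def)
  then obtain p where p: "cyc p" "set p \<subseteq> S" "length p = 4" using fits4_cycle[OF fit _ pos] by blast
  have nonempty: "S - set q \<noteq> {}" if q: "cyc q" "set q \<subseteq> S" "length q = 4" for q
  proof -
    have "hd q \<in> S" using q by (auto simp: cyc_def)
    then have "3 \<le> outd S (hd q)" using Suc.prems(3)[of "hd q"] Suc.hyps by auto
    then show ?thesis using escape_cycle[OF fit q \<open>hd q \<in> S\<close>] by blast
  qed
  obtain K where K: "terminal (S - set p) K" using terminal_exists[of "S - set p"] nonempty[OF p] fin by auto
  have rest: "fits 4 K \<and> strong K \<and> (\<forall>v\<in>K. 2 * k - 1 \<le> outd K v) \<and> uniform K k"
    if q: "cyc q" "set q \<subseteq> S" "length q = 4" and K: "terminal (S - set q) K" for q K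
  proof -
    have KS: "K \<subseteq> S - set q" using terminal_sub(1)[OF K] .
    have "2 * k - 1 \<le> outd K v" if "v \<in> K" for v
      using outd_remove_terminal[OF fit q K that] Suc.prems(3)[of v] KS that by auto
    moreover have "uniform K k" using uniform_remove[OF Suc.prems(4) q(1,2)] uniform_mono KS by blast
    ultimately show ?thesis using fits_mono[OF fit, of K] KS terminal_sub(2)[OF K] by blast
  qed
  note RK = rest[OF p K]
  have KS: "K \<subseteq> S - set p" using terminal_sub(1)[OF K] .
  obtain z where z: "z \<in> K" "card {v \<in> K. c v = c z} = 2 * k" using Suc.IH[of K] RK by blast
  define Y where "Y = {v \<in> K. c v = c z}"
  have zS: "z \<in> S" using z KS by blast
  have kk: "2 * k = Suc (2 * k - 1)" using Suc.hyps by simp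
  have inK: "\<exists>y\<in>Y. E y x \<and> (\<forall>y'\<in>Y - {y}. E x y') \<and> outd K x \<le> 2 * k - 1" if "x \<in> K" "c x \<noteq> c z" for x
    using unique_in_neighbour[OF _ _ z(1) Y_def _ _ that, of "2 * k - 1"] RK z(2) kk unfolding Y_def by simp
  have degK: "3 \<le> outd K v" if "v \<in> K" for v
  proof -
    have "2 * k - 1 \<le> outd K v" using RK that by blast
    then show ?thesis using Suc.hyps by linarith
  qed
  have posK: "0 < outd K v" if "v \<in> K" for v using degK[OF that] by simp
  obtain q where q: "cyc q" "set q \<subseteq> K" "length q = 4"
    using fits4_cycle[OF _ terminal_sub(3)[OF K] posK] RK by blast
  have qS: "set q \<subseteq> S" using q KS by blast
  have esc: "\<exists>x\<in>K - set q. E v x" if "v \<in> K" for v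
    using escape_cycle[OF fit q(1) qS q(3) _ degK[OF that]] that KS by blast
  obtain K' where K': "terminal (S - set q) K'" using terminal_exists[of "S - set q"] nonempty[OF q(1) qS q(3)] fin by auto
  note RK' = rest[OF q(1) qS q(3) K']
  have KS': "K' \<subseteq> S - set q" using terminal_sub(1)[OF K'] .
  have outK: "v \<in> K \<or> v \<in> set p" if "u \<in> K" "v \<in> S" "E u v" for u v
    using terminalD[OF K that(1) _ that(3)] that(2) by blast
  have outK': "v \<in> K' \<or> v \<in> set q" if "u \<in> K'" "v \<in> S" "E u v" for u v
    using terminalD[OF K' that(1) _ that(3)] that(2) by blast
  have two: "c v = c z \<longleftrightarrow> c v \<noteq> c x" if "v \<in> S" "x \<in> S" "c x \<noteq> c z" for v x
    using two_colours_eq[OF SV that(2) zS that(1)] that(3) by auto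
  obtain x0 where x0: "x0 \<in> K - set q" "E z x0" using esc[OF z(1)] by blast
  have cx0: "c x0 \<noteq> c z" using arc_colours[OF x0(2)] by simp
  have x0S: "x0 \<in> S" using x0 KS by blast
  define Yp where "Yp = {v \<in> set p. c v = c z}"
  have "Yp = {v \<in> set p. c v \<noteq> c x0}" unfolding Yp_def using two[OF _ x0S cx0] p(2) by blast
  then have cYp: "card Yp = 2" using fits_adj[OF fit p x0S] by simp
  have "{v \<in> set q. c v = c z} = {v \<in> set q. c v \<noteq> c x0}" using two[OF _ x0S cx0] qS by blast
  then have cYq: "card {v \<in> set q. c v = c z} = 2" using fits_adj[OF fit q(1) qS q(3) x0S] by simp
  have finK: "finite K" using KS fin finite_subset by blast
  have "Y - set q = Y - {v \<in> set q. c v = c z}" unfolding Y_def by blast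
  then have cYr: "card (Y - set q) = 2 * k - 2"
    using card_Diff_subset[of "{v \<in> set q. c v = c z}" Y] cYq z(2) q(2) unfolding Y_def by auto
  have XYp: "E x a" if x: "x \<in> K" "c x \<noteq> c z" "a \<in> Yp" for x a
  proof -
    have xS: "x \<in> S" using x KS by blast
    have "outs S x = outs (S - set p) x \<union> outs (set p) x" using p(2) by (auto simp: outs_def)
    then have "outd S x \<le> outd (S - set p) x + outd (set p) x" by (metis card_Un_le)
    moreover have "outd K x \<le> 2 * k - 1" using inK[OF x(1,2)] by blast
    ultimately have "2 \<le> outd (set p) x" using terminal_outd[OF K x(1)] Suc.prems(3)[OF xS] Suc.hyps by simp
    moreover have "c a \<noteq> c x" "a \<in> set p" using x by (auto simp: Yp_def)
    ultimately show ?thesis using outd_cycle_full[OF fit p xS] by blast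
  qed
  (* Otherwise a vertex of K' off p would dominate some vertex of K off q, as K - set q has both
     colours; and K' cannot lie on p because its out-degrees are at least 3. *)
  have meets: "K \<inter> K' \<noteq> {}"
  proof
    assume disj: "K \<inter> K' = {}"
    have "K' \<subseteq> set p"
    proof
      fix r assume r: "r \<in> K'"
      show "r \<in> set p"
      proof (rule ccontr)
        assume rp: "r \<notin> set p"
        have rS: "r \<in> S" "r \<notin> K" using r KS' disj by auto
        have "Y - set q \<noteq> {}" 
        proof
          assume "Y - set q = {}"
          then have "card (Y - set q) = 0" by (simp only: card.empty)
          then show False using cYr Suc.hyps by simp
        qed
        then obtain y where y: "y \<in> K" "y \<notin> set q" "c y = c z" by (auto simp: Y_def)
        have "\<exists>u. u \<in> K \<and> u \<notin> set q \<and> c r \<noteq> c u" using y x0 cx0 by (cases "c r = c z") auto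
        then obtain u where u: "u \<in> K" "u \<notin> set q" "c r \<noteq> c u" by blast
        have "\<not> E u r" using outK[OF u(1) rS(1)] rS rp by blast
        then have "E r u" using arc_total[of r u] rS u KS SV by blast
        then show False using outK'[OF r] u KS disj by blast
      qed
    qed
    moreover obtain r where r: "r \<in> K'" using terminal_sub(3)[OF K'] by blast
    ultimately have "outd K' r \<le> outd (set p) r" "r \<in> S" using outd_mono p(2) by blast+
    moreover have "outd (set p) r \<le> 2" using outd_cycle_le[OF fit p \<open>r \<in> S\<close>] .
    moreover have "2 * k - 1 \<le> outd K' r" using RK' r by blast
    ultimately show False using Suc.hyps by linarith
  qed
  then obtain v where v: "v \<in> K" "v \<in> K'" by blast
  obtain x where x: "x \<in> K" "x \<in> K'" "c x \<noteq> c z"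
  proof (cases "c v = c z")
    case True
    obtain x where x: "x \<in> K" "x \<notin> set q" "E v x" using esc[OF v(1)] by blast
    then have "x \<in> K'" using outK'[OF v(2)] KS by blast
    then show ?thesis using that[of x] x arc_colours[OF x(3)] True by simp
  qed (use v that in blast)
  obtain y where y: "y \<in> Y" "E y x" "\<And>y'. y' \<in> Y \<Longrightarrow> y' \<noteq> y \<Longrightarrow> E x y'" using inK[OF x(1,3)] by blast
  have YS: "Y \<subseteq> S" using KS by (auto simp: Y_def)
  have YpK': "Yp \<subseteq> K'"
  proof
    fix a assume a: "a \<in> Yp"
    then have "a \<in> S" "a \<notin> set q" using p KS q by (auto simp: Yp_def)
    then show "a \<in> K'" using outK'[OF x(2)] XYp[OF x(1,3) a] by blast
  qed
  (* A second vertex x2 of K', outside Y and with another in-neighbour than x, reaches the vertex y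
     of Y that x does not dominate. *)
  have "\<exists>y1. y1 \<in> Y - set q \<and> y1 \<noteq> y"
  proof (rule ccontr)
    assume "\<not> ?thesis"
    then have "Y - set q \<subseteq> {y}" by blast
    then have "card (Y - set q) \<le> 1" using card_mono[of "{y}" "Y - set q"] by simp
    then show False using cYr Suc.hyps by simp
  qed
  then obtain y1 where y1: "y1 \<in> Y" "y1 \<notin> set q" "y1 \<noteq> y" by blast
  have y1K': "y1 \<in> K'" using outK'[OF x(2) _ y(3)] y1 YS by blast
  have "y1 \<in> K" using y1 by (simp add: Y_def)
  then obtain x2 where x2: "x2 \<in> K" "x2 \<notin> set q" "E y1 x2" using esc by blast
  have cx2: "c x2 \<noteq> c z" using arc_colours[OF x2(3)] y1 by (simp add: Y_def)
  have x2K': "x2 \<in> K'" using outK'[OF y1K' _ x2(3)] x2 KS by blast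
  have "x \<noteq> x2" using y(3)[OF y1(1,3)] x2(3) arc_asym by blast
  obtain y2 where y2: "y2 \<in> Y" "\<And>y'. y' \<in> Y \<Longrightarrow> y' \<noteq> y2 \<Longrightarrow> E x2 y'" using inK[OF x2(1) cx2] by blast
  have "y2 = y1" using y2(2)[OF y1(1)] x2(3) arc_asym by blast
  have YK': "Y - set q \<subseteq> K'"
  proof
    fix t assume t: "t \<in> Y - set q"
    then have "E x t \<or> E x2 t" using y(3)[of t] y2(2)[of t] \<open>y2 = y1\<close> y1(3) by auto
    then show "t \<in> K'" using outK'[OF x(2), of t] outK'[OF x2K', of t] t YS by blast
  qed
  obtain z' where z': "z' \<in> K'" "card {v \<in> K'. c v = c z'} = 2 * k" using Suc.IH[of K'] RK' by blast
  (* Otherwise a vertex a of Yp would have a single in-neighbour in K', but x and x2 dominate a. *)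
  have cz: "c z' = c z"
  proof (rule ccontr)
    assume ne: "c z' \<noteq> c z"
    obtain a where a: "a \<in> Yp" using cYp by (metis card.empty equals0I zero_neq_numeral)
    have az: "c a = c z" "a \<in> K'" using a YpK' by (auto simp: Yp_def)
    then have "c a \<noteq> c z'" using ne by simp
    then obtain t where t: "\<And>y'. y' \<in> K' \<Longrightarrow> c y' = c z' \<Longrightarrow> y' \<noteq> t \<Longrightarrow> E a y'"
      using unique_in_neighbour[OF _ _ z'(1) refl _ _ az(2), of "2 * k - 1"] RK' z'(2) kk by auto
    have z'S: "z' \<in> S" using z' KS' by blast
    have "c x = c z'" "c x2 = c z'" using two[OF _ z'S ne] x x2 cx2 KS by blast+
    then have "E a x \<or> E a x2" using t x(2) x2K' \<open>x \<noteq> x2\<close> by metis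
    then show False using XYp[OF x(1,3) a] XYp[OF x2(1) cx2 a] arc_asym by blast
  qed
  have disYp: "Yp \<inter> Y = {}" using KS by (auto simp: Y_def Yp_def)
  have finY: "finite Y" "finite Yp" using finK by (auto simp: Y_def Yp_def)
  have YY: "{v \<in> K'. c v = c z} = Yp \<union> (Y - set q)"
  proof (rule sym, rule card_subset_eq)
    show "finite {v \<in> K'. c v = c z}" using KS' by (intro finite_subset[OF _ fin]) blast
    show "Yp \<union> (Y - set q) \<subseteq> {v \<in> K'. c v = c z}" using YpK' YK' by (auto simp: Y_def Yp_def)
    have "card (Yp \<union> (Y - set q)) = 2 + (2 * k - 2)"
      using disYp finY cYp cYr by (subst card_Un_disjoint) auto
    then show "card (Yp \<union> (Y - set q)) = card {v \<in> K'. c v = c z}" using z'(2) cz kk Suc.hyps by simp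
  qed
  have "Yp \<noteq> {}" using cYp by auto
  then have "set p \<inter> K' \<noteq> {}" using YpK' by (auto simp: Yp_def)
  then have pK': "set p \<subseteq> K'"
    using cyc_closed[OF p(1), of "S - set q" K'] p(2) q(2) KS K' by (auto simp: terminal_def)
  have "out_closed S (K \<union> K')" unfolding out_closed_def using outK outK' pK' q(2) KS KS' by blast
  then have SKK: "S = K \<union> K'" using Suc.prems(2) terminal_sub(3)[OF K] unfolding strong_def by blast
  have "{v \<in> S. c v = c z} = Y \<union> {v \<in> K'. c v = c z}" unfolding SKK Y_def by blast
  also have "\<dots> = Y \<union> Yp" unfolding YY by blast
  finally have "card {v \<in> S. c v = c z} = card (Y \<union> Yp)" by simp
  also have "\<dots> = 2 * k + 2" using disYp finY cYp z(2) unfolding Y_def[symmetric] by (subst card_Un_disjoint) auto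
  finally show ?case using zS by (intro bexI[of _ z]) auto
qed

section \<open>Uniform digraphs and packings in bipartite components\<close>

text \<open>
  Choose three vertices of \<open>Y\<close> and an out-neighbour of each.  Such an out-neighbour dominates all
  other vertices of \<open>Y\<close>.
\<close>
lemma six_cycle:
  assumes Y: "Y \<subseteq> K" "4 \<le> card Y"
    and out: "\<forall>y\<in>Y. \<exists>x\<in>K - Y. E y x"
    and xs: "\<forall>x\<in>K - Y. \<exists>y\<in>Y. \<forall>y'\<in>Y - {y}. E x y'"
  shows "\<exists>y1 x1 y2 x2 y3 x3. cyc [y1, x1, y2, x2, y3, x3] \<and> {y1, y2, y3} \<subseteq> Y \<and> {x1, x2, x3} \<subseteq> K - Y"
proof -
  obtain T where T: "T \<subseteq> Y" "card T = 3" using obtain_subset_with_card_n[of 3 Y] Y(2) by auto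
  then obtain y1 y2 y3 where y: "T = {y1, y2, y3}" "y1 \<noteq> y2" "y1 \<noteq> y3" "y2 \<noteq> y3" by (auto simp: card_Suc_eq numeral_3_eq_3)
  have yY: "y1 \<in> Y" "y2 \<in> Y" "y3 \<in> Y" using y(1) T by auto
  obtain x1 where x1: "x1 \<in> K - Y" "E y1 x1" using out yY by blast
  obtain x2 where x2: "x2 \<in> K - Y" "E y2 x2" using out yY by blast
  obtain x3 where x3: "x3 \<in> K - Y" "E y3 x3" using out yY by blast
  have dom: "E x y'" if "x \<in> K - Y" "y \<in> Y" "E y x" "y' \<in> Y" "y' \<noteq> y" for x y y'
    using xs that arc_asym by blast
  have arcs: "E x1 y2" "E x2 y3" "E x3 y1" "E x1 y3" "E x2 y1"
    using dom[OF x1(1) yY(1) x1(2)] dom[OF x2(1) yY(2) x2(2)] dom[OF x3(1) yY(3) x3(2)] yY y(2-4) by auto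
  have "x1 \<noteq> x2" using arcs(1) x2(2) arc_asym by blast
  moreover have "x2 \<noteq> x3" using arcs(2) x3(2) arc_asym by blast
  moreover have "x1 \<noteq> x3" using arcs(4) x3(2) arc_asym by blast
  moreover have "y \<noteq> x" if "y \<in> Y" "x \<in> K - Y" for x y using that by blast
  ultimately have "distinct [y1, x1, y2, x2, y3, x3]" using y(2-4) yY x1(1) x2(1) x3(1) by auto
  then have "cyc [y1, x1, y2, x2, y3, x3]" using arcs x1 x2 x3 by (simp add: cyc_iff)
  then show ?thesis using yY x1 x2 x3 by blast
qed

text \<open>
  A 6-cycle of \<open>K\<close> costs each vertex at most three out-neighbours, which leaves enough for
  \<open>k - 2\<close> further disjoint cycles.  Together with a cycle of length 3 or 4 outside \<open>K\<close> they form a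
  packing with two lengths.
\<close>
lemma no_outside_cycle:
  assumes k: "2 \<le> k" and S: "S \<subseteq> V" "uniform S k"
    and K: "K \<subseteq> S" "fits 4 K" "strong K" "\<And>v. v \<in> K \<Longrightarrow> 2 * k - 1 \<le> outd K v"
    and z: "z \<in> K" "card {v \<in> K. c v = c z} = 2 * k"
    and q: "cyc q" "set q \<subseteq> S - K"
  shows False
proof -
  define Y where "Y = {v \<in> K. c v = c z}"
  have kk: "2 * k = Suc (2 * k - 1)" using k by simp
  have KV: "K \<subseteq> V" "card (c ` K) \<le> 2" using K(2) by (auto simp: fits_def)
  have one: "\<exists>y\<in>Y. \<forall>y'\<in>Y - {y}. E x y'" if "x \<in> K - Y" for x
    using unique_in_neighbour[OF K(3,2) z(1) Y_def _ K(4), of x] that z(2) kk unfolding Y_def by auto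
  have out: "\<exists>x\<in>K - Y. E y x" if "y \<in> Y" for y
  proof -
    have "y \<in> K" using that by (simp add: Y_def)
    then have "0 < outd K y" using K(4)[of y] k by simp
    then obtain x where x: "x \<in> K" "E y x" by (rule outd_posE)
    then have "x \<notin> Y" using arc_colours that by (fastforce simp: Y_def)
    then show ?thesis using x by blast
  qed
  have Ysub: "Y \<subseteq> K" by (auto simp: Y_def)
  have Ycard: "4 \<le> card Y" using z(2) k by (simp add: Y_def)
  have allY: "\<forall>y\<in>Y. \<exists>x\<in>K - Y. E y x" "\<forall>x\<in>K - Y. \<exists>y\<in>Y. \<forall>y'\<in>Y - {y}. E x y'"
    by (rule ballI, erule out) (rule ballI, erule one)
  from six_cycle[OF Ysub Ycard allY]
  obtain y1 x1 y2 x2 y3 x3 where r: "cyc [y1, x1, y2, x2, y3, x3]" "{y1, y2, y3} \<subseteq> Y" "{x1, x2, x3} \<subseteq> K - Y"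
    by (elim exE conjE) (rule that)
  let ?r = "[y1, x1, y2, x2, y3, x3]"
  have rK: "set ?r \<subseteq> K" using r(2,3) by (auto simp: Y_def)
  have three: "outd (set ?r) v \<le> 3" if v: "v \<in> K" for v
  proof -
    have "c x1 = c x2" "c x2 = c x3"
      using two_colours_eq[OF KV, of z x1 x2] two_colours_eq[OF KV, of z x2 x3] z(1) r(3) by (auto simp: Y_def)
    then have xs: "c u = c x1" if "u \<in> {x1, x2, x3}" for u using that by auto
    have ys: "c u = c z" if "u \<in> {y1, y2, y3}" for u using that r(2) by (auto simp: Y_def)
    have in_outs: "E v u \<and> (u \<in> {y1, y2, y3} \<or> u \<in> {x1, x2, x3})" if "u \<in> outs (set ?r) v" for u
      using that by (auto simp: outs_def)
    have "c v = c z \<or> c v = c x1" using two_colours_eq[OF KV, of z x1 v] z(1) r(3) v by (auto simp: Y_def)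
    then have "outs (set ?r) v \<subseteq> {y1, y2, y3} \<or> outs (set ?r) v \<subseteq> {x1, x2, x3}"
    proof
      assume "c v = c z"
      then show ?thesis using in_outs ys arc_colours by (metis subsetI)
    next
      assume "c v = c x1"
      then show ?thesis using in_outs xs arc_colours by (metis subsetI)
    qed
    then have "outd (set ?r) v \<le> card {y1, y2, y3} \<or> outd (set ?r) v \<le> card {x1, x2, x3}"
      using card_mono[of "{y1, y2, y3}" "outs (set ?r) v"] card_mono[of "{x1, x2, x3}" "outs (set ?r) v"] by blast
    moreover have "card {y1, y2, y3} \<le> 3" "card {x1, x2, x3} \<le> 3"
      by (metis card_length length_Cons list.set list.size(3) numeral_3_eq_3)+
    ultimately show ?thesis by linarith
  qed
  have deg: "2 * (k - 2) \<le> outd (K - set ?r) v" if v: "v \<in> K" for v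
  proof -
    have "outs K v = outs (K - set ?r) v \<union> outs (set ?r) v" using rK by (auto simp: outs_def)
    then have "outd K v \<le> outd (K - set ?r) v + outd (set ?r) v" by (metis card_Un_le)
    then show ?thesis using three[OF v] K(4)[OF v] k by linarith
  qed
  have ne: "K - set ?r \<noteq> {}" if "0 < k - 2"
  proof -
    have "0 < outd (K - set ?r) z" using deg[OF z(1)] that by linarith
    then show ?thesis by (auto elim: outd_posE)
  qed
  have "card (c ` (K - set ?r)) \<le> 3" using card_colours_mono[OF finite_sub[OF KV(1)], of "K - set ?r"] KV(2) by auto
  moreover have "K - set ?r \<subseteq> V" using KV(1) by blast
  ultimately have fT: "fits 3 (K - set ?r)" unfolding fits_def by blast
  have "\<exists>F. packing (K - set ?r) (k - 2) F"
  proof (rule packing_exists[OF fT ne])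
    fix v assume "v \<in> K - set ?r"
    then have "2 * (k - 2) \<le> outd (K - set ?r) v" by (intro deg) blast
    then show "2 * (k - 2) - 1 \<le> outd (K - set ?r) v" by linarith
  qed
  then obtain F where F: "packing (K - set ?r) (k - 2) F" by blast
  have "set ?r \<subseteq> S - set q" "K - set ?r \<subseteq> S - set q - set ?r" using rK q(2) K(1) by blast+
  then have "packing (S - set q) (Suc (k - 2)) (insert ?r F)" by (rule packing_insert[OF F r(1)])
  moreover obtain q' where q': "cyc q'" "set q' \<subseteq> set q" "length q' = 3 \<or> length q' = 4"
    using short_cyc_inside[OF q(1)] by blast
  ultimately have "packing S (Suc (Suc (k - 2))) (insert q' (insert ?r F))"
    using packing_insert[of "S - set q" "Suc (k - 2)" "insert ?r F" q' S] q(2) by blast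
  then have "packing S k (insert q' (insert ?r F))" using k by (simp add: numeral_2_eq_2 Suc_diff_Suc)
  then have "length q' = length ?r" using S(2) unfolding uniform_def by blast
  then show False using q'(3) by simp
qed

text \<open>The successor on the cycle maps each of the two colours injectively into the other.\<close>
lemma bipartite_cycle_half:
  assumes "cyc p" "set p \<subseteq> K" "fits 4 K" "z \<in> K"
  shows "length p = 2 * card {v \<in> set p. c v = c z}"
proof -
  have KV: "K \<subseteq> V" "card (c ` K) \<le> 2" using assms(3) by (auto simp: fits_def)
  let ?n = "length p"
  define A where "A = {i. i < ?n \<and> c (p ! i) = c z}"
  define B where "B = {i. i < ?n \<and> c (p ! i) \<noteq> c z}"
  let ?s = "\<lambda>i. Suc i mod ?n"
  have n: "0 < ?n" using assms(1) by (auto simp: cyc_def)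
  have arc: "E (p ! i) (p ! ?s i)" if "i < ?n" for i using assms(1) that unfolding cyc_def by blast
  have mem: "p ! i \<in> K" if "i < ?n" for i using assms(2) that by auto
  have inj: "inj_on ?s {i. i < ?n}" by (rule inj_onI) (auto simp: mod_Suc split: if_splits)
  have alt: "c (p ! i) = c z \<longleftrightarrow> c (p ! ?s i) \<noteq> c z" if i: "i < ?n" for i
  proof -
    have si: "?s i < ?n" using n by simp
    have ne: "c (p ! i) \<noteq> c (p ! ?s i)" using arc_colours[OF arc[OF i]] .
    show ?thesis using two_colours_eq[OF KV mem[OF i] mem[OF si] assms(4) ne] ne by metis
  qed
  have fin: "finite A" "finite B" by (auto simp: A_def B_def)
  have "?s i \<in> B" if "i \<in> A" for i using alt[of i] that n unfolding A_def B_def by simp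
  moreover have "?s i \<in> A" if "i \<in> B" for i using alt[of i] that n unfolding A_def B_def by simp
  ultimately have "?s ` A \<subseteq> B" "?s ` B \<subseteq> A" by blast+
  moreover have "inj_on ?s A" by (rule inj_on_subset[OF inj]) (auto simp: A_def)
  moreover have "inj_on ?s B" by (rule inj_on_subset[OF inj]) (auto simp: B_def)
  ultimately have "card A \<le> card B" "card B \<le> card A" using fin by (metis card_inj_on_le)+
  moreover have "{..<?n} = A \<union> B" "A \<inter> B = {}" by (auto simp: A_def B_def)
  then have "?n = card A + card B" using fin by (metis card_Un_disjoint card_lessThan)
  moreover have "{v \<in> set p. c v = c z} = (!) p ` A" by (auto simp: A_def in_set_conv_nth)
  then have "card {v \<in> set p. c v = c z} = card A"
    using assms(1) by (simp add: card_image A_def cyc_def inj_on_nth)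
  ultimately show ?thesis by simp
qed

text \<open>
  Each of the \<open>k\<close> cycles has at least two vertices of the colour of \<open>z\<close>, and there are only \<open>2 * k\<close> of
  them.
\<close>
lemma packing_length_four:
  assumes K: "fits 4 K" "z \<in> K" "card {v \<in> K. c v = c z} = 2 * k"
    and F: "packing K k F" and p: "p \<in> F"
  shows "length p = 4"
proof -
  let ?Y = "\<lambda>q. {v \<in> set q. c v = c z}"
  have half: "length q = 2 * card (?Y q)" if "q \<in> F" for q
    using bipartite_cycle_half[OF _ _ K(1,2)] F that unfolding packing_def by blast
  have two: "2 \<le> card (?Y q)" if "q \<in> F" for q
  proof -
    have "3 \<le> length q" using cyc_ge3 F that unfolding packing_def by blast
    then show ?thesis using half[OF that] by simp
  qed
  have finF: "finite F" "card F = k" using F by (auto simp: packing_def)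
  have finK: "finite K" using K(1) finite_sub by (simp add: fits_def)
  have "(\<Sum>q\<in>F. card (?Y q)) = card (\<Union>q\<in>F. ?Y q)"
  proof (rule card_UN_disjoint[symmetric])
    show "\<forall>i\<in>F. \<forall>j\<in>F. i \<noteq> j \<longrightarrow> ?Y i \<inter> ?Y j = {}" using F unfolding packing_def by blast
  qed (use finF in auto)
  also have "\<dots> \<le> card {v \<in> K. c v = c z}"
    using finK F by (intro card_mono) (auto simp: packing_def)
  finally have "(\<Sum>q\<in>F. card (?Y q)) \<le> (\<Sum>q\<in>F. 2)" using K(3) finF by simp
  moreover have "(\<Sum>q\<in>F. card (?Y q)) = card (?Y p) + (\<Sum>q\<in>F - {p}. card (?Y q))"
    "(\<Sum>q\<in>F. 2) = 2 + (\<Sum>q\<in>F - {p}. (2::nat))" using finF(1) p by (simp_all add: sum.remove del: sum_constant)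
  moreover have "(\<Sum>q\<in>F - {p}. (2::nat)) \<le> (\<Sum>q\<in>F - {p}. card (?Y q))" using two by (intro sum_mono) auto
  ultimately have "card (?Y p) \<le> 2" by linarith
  then show ?thesis using two[OF p] half[OF p] by simp
qed

lemma uniform_structure:
  assumes k: "2 \<le> k" and V: "card (c ` V) \<le> 3" "V \<noteq> {}" and deg: "\<And>v. v \<in> V \<Longrightarrow> 2 * k - 1 \<le> outd V v"
    and hom: "uniform V k"
  shows "\<exists>K z. terminal V K \<and> fits 4 K \<and> z \<in> K \<and> card {v \<in> K. c v = c z} = 2 * k \<and>
    (\<forall>q. cyc q \<longrightarrow> set q \<inter> K \<noteq> {})"
proof -
  have fit: "fits 3 V" using V by (simp add: fits_def)
  obtain K where K: "terminal V K" using terminal_exists[OF finite_V V(2)] by blast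
  note KV = terminal_sub(1)[OF K]
  have "length p \<noteq> 3" if "cyc p" "set p \<subseteq> K" for p using uniform_no_triangle[OF k fit deg hom that(1)] cyc_in_V that by blast
  then have "card (c ` K) \<le> 2"
    using triangle_free_bipartite[OF _ terminal_sub(2)[OF K] KV] fits_mono[OF fit KV] by (simp add: fits_def)
  then have fK: "fits 4 K" using KV by (simp add: fits_def)
  have dK: "2 * k - 1 \<le> outd K v" if "v \<in> K" for v using deg terminal_outd[OF K that] that KV by auto
  obtain z where z: "z \<in> K" "card {v \<in> K. c v = c z} = 2 * k"
    using uniform_colour_class[OF k fK terminal_sub(2)[OF K] dK uniform_mono[OF hom KV]] by blast
  have "set q \<inter> K \<noteq> {}" if "cyc q" for q
    using no_outside_cycle[OF k order_refl hom KV fK terminal_sub(2)[OF K] dK z that] cyc_in_V[OF that] by blast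
  then show ?thesis using K fK z by blast
qed

end

section \<open>Multipartite tournaments as coloured tournaments\<close>

definition part_of :: "'a set set \<Rightarrow> 'a \<Rightarrow> 'a set" where
  "part_of P v = (THE S. S \<in> P \<and> v \<in> S)"

lemma part_of_eq:
  assumes "partition_on A P" "S \<in> P" "v \<in> S"
  shows "part_of P v = S"
  unfolding part_of_def
proof (rule the_equality)
  fix T assume "T \<in> P \<and> v \<in> T"
  then show "T = S" using assms partition_onD2 by (meson disjoint_def disjoint_iff)
qed (use assms in blast)

lemma complete_multipartite_edge_iff:
  "{x, y} \<in> complete_multipartite_edges P \<longleftrightarrow> (\<exists>S\<in>P. \<exists>T\<in>P. S \<noteq> T \<and> x \<in> S \<and> y \<in> T)"
proof
  assume "{x, y} \<in> complete_multipartite_edges P"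
  then obtain x' y' S T where "{x, y} = {x', y'}" "S \<in> P" "T \<in> P" "S \<noteq> T" "x' \<in> S" "y' \<in> T"
    unfolding complete_multipartite_edges_def by blast
  then show "\<exists>S\<in>P. \<exists>T\<in>P. S \<noteq> T \<and> x \<in> S \<and> y \<in> T" by (metis doubleton_eq_iff)
qed (unfold complete_multipartite_edges_def, blast)

lemma edge_iff_part_of:
  assumes "partition_on A P" "x \<in> A" "y \<in> A"
  shows "{x, y} \<in> complete_multipartite_edges P \<longleftrightarrow> part_of P x \<noteq> part_of P y"
proof -
  have "\<Union>P = A" using partition_onD1[OF assms(1)] by simp
  then obtain S T where "S \<in> P" "x \<in> S" "T \<in> P" "y \<in> T" using assms(2,3) by blast
  then show ?thesis unfolding complete_multipartite_edge_iff using part_of_eq[OF assms(1)] by metis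
qed

locale multipartite_tournament = digraph G for G :: "('a, 'b) pre_digraph" (structure) +
  fixes P :: "'a set set"
  assumes on_parts: "multipartite_tournament_on P G" and finite_parts: "finite P"
begin

lemma partition_parts: "partition_on (verts G) P"
  using on_parts by (simp add: multipartite_tournament_on_def)

lemma dominates_part_of: "u \<rightarrow> v \<Longrightarrow> part_of P u \<noteq> part_of P v"
  using on_parts edge_iff_part_of[OF partition_parts] adj_in_verts
  unfolding multipartite_tournament_on_def orientation_of_def by metis

lemma dominates_xor: "u \<in> verts G \<Longrightarrow> v \<in> verts G \<Longrightarrow> part_of P u \<noteq> part_of P v \<Longrightarrow> (u \<rightarrow> v) \<noteq> (v \<rightarrow> u)"
  using on_parts edge_iff_part_of[OF partition_parts]
  unfolding multipartite_tournament_on_def orientation_of_def by metis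

sublocale coloured_tournament "verts G" "dominates G" "part_of P"
proof
  show "\<not> v \<rightarrow> u" if "u \<rightarrow> v" for u v
    using dominates_xor[OF adj_in_verts[OF that] dominates_part_of[OF that]] that by blast
  show "(u \<rightarrow> v) \<or> (v \<rightarrow> u)" if "u \<in> verts G" "v \<in> verts G" "part_of P u \<noteq> part_of P v" for u v
    using dominates_xor[OF that] by blast
  show "finite (verts G)" by simp
qed (erule adj_in_verts dominates_part_of | rule conjI)+

lemma part_of_in_parts: "v \<in> verts G \<Longrightarrow> part_of P v \<in> P"
  using partition_parts part_of_eq by (metis UnionE partition_onD1)

lemma card_colours: "card (part_of P ` verts G) \<le> card P"
  using part_of_in_parts finite_parts by (intro card_mono) auto

lemma out_degree_eq_outd: "out_degree G v = outd (verts G) v"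
proof -
  have "inj_on (head G) (out_arcs G v)"
    by (rule inj_onI) (auto intro: no_multi_arcs simp: arc_to_ends_def)
  moreover have "head G ` out_arcs G v = outs (verts G) v"
    unfolding outs_def by (auto simp: arcs_ends_conv)
  ultimately show ?thesis unfolding out_degree_def by (metis card_image)
qed

lemma min_out_degree_le: "v \<in> verts G \<Longrightarrow> min_out_degree G \<le> outd (verts G) v"
  unfolding min_out_degree_def by (auto simp: out_degree_eq_outd intro!: Min_le)

lemma cas_iff: "p \<noteq> [] \<Longrightarrow> cas u p v \<longleftrightarrow> tail G (hd p) = u \<and> head G (last p) = v \<and>
    successively (\<lambda>a b. head G a = tail G b) p"
proof (induction p arbitrary: u)
  case (Cons a p)
  show ?case
  proof (cases "p = []")
    case False
    then show ?thesis using Cons.IH[OF False, of "head G a"] by (simp add: successively_Cons) metis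
  qed simp
qed simp

lemma cas_heads: "p \<noteq> [] \<Longrightarrow> cas u p u \<Longrightarrow> map (head G) p = rotate1 (map (tail G) p)"
proof -
  have *: "p \<noteq> [] \<Longrightarrow> cas u p v \<Longrightarrow> map (head G) p = tl (map (tail G) p) @ [v]" for v
  proof (induction p arbitrary: u)
    case (Cons a p)
    then show ?case by (cases p) auto
  qed simp
  assume p: "p \<noteq> []" "cas u p u"
  have "tail G (hd p) = u" using p cas_iff by blast
  then show ?thesis using *[OF p] p(1) by (cases p) auto
qed

lemma awalk_verts_cas: "cas u p v \<Longrightarrow> awalk_verts u p = u # map (head G) p"
  by (induction p arbitrary: u) auto

text \<open>Without parallel arcs, a cycle as an arc list corresponds to the list of the tails of its arcs.\<close>
lemma cycle_iff_cyc:
  "cycle p \<longleftrightarrow> set p \<subseteq> arcs G \<and> cyc (map (tail G) p) \<and>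
    successively (\<lambda>a b. head G a = tail G b) p \<and> head G (last p) = tail G (hd p)"
    (is "_ \<longleftrightarrow> ?R")
proof
  assume "cycle p"
  then obtain u where u: "u \<in> verts G" "set p \<subseteq> arcs G" "cas u p u" "distinct (tl (awalk_verts u p))" "p \<noteq> []"
    unfolding cycle_def awalk_def by blast
  have c: "tail G (hd p) = u" "head G (last p) = u" "successively (\<lambda>a b. head G a = tail G b) p"
    using cas_iff[OF u(5)] u(3) by blast+
  have "distinct (map (tail G) p)" using u(4) cas_heads[OF u(5,3)] awalk_verts_cas[OF u(3)] by simp
  moreover have arc: "tail G a \<rightarrow> head G a" if "a \<in> set p" for a
    using that u(2) by (auto simp: arcs_ends_conv)
  have "successively (dominates G) (map (tail G) p)" unfolding successively_map
    by (rule successively_mono[OF c(3)]) (use arc in metis)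
  moreover have "tail G (last p) \<rightarrow> tail G (hd p)" using arc[of "last p"] u(5) c by simp
  ultimately have "cyc (map (tail G) p)" using u(5) by (simp add: cyc_iff last_map hd_map)
  then show ?R using u c by simp
next
  assume R: ?R
  then have p: "p \<noteq> []" "distinct (map (tail G) p)" by (auto simp: cyc_def)
  then have cas: "cas (tail G (hd p)) p (tail G (hd p))" using cas_iff[OF p(1)] R by blast
  have "hd p \<in> arcs G" using p R by auto
  then have "awalk (tail G (hd p)) p (tail G (hd p))" unfolding awalk_def using cas R by simp
  moreover have "distinct (tl (awalk_verts (tail G (hd p)) p))"
    using cas_heads[OF p(1) cas] awalk_verts_cas[OF cas] p(2) by simp
  ultimately show "cycle p" unfolding cycle_def using p(1) by blast
qed

lemma cyc_imp_cycle:
  assumes "cyc q"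
  shows "\<exists>p. cycle p \<and> map (tail G) p = q"
proof -
  let ?n = "length q"
  have n: "0 < ?n" using assms by (auto simp: cyc_def)
  have "\<forall>i. \<exists>e. i < ?n \<longrightarrow> e \<in> arcs G \<and> tail G e = q ! i \<and> head G e = q ! (Suc i mod ?n)"
    using assms unfolding cyc_def by (metis reachableE)
  then obtain g where g: "\<And>i. i < ?n \<Longrightarrow> g i \<in> arcs G \<and> tail G (g i) = q ! i \<and> head G (g i) = q ! (Suc i mod ?n)"
    by metis
  let ?p = "map g [0..<?n]"
  have t: "map (tail G) ?p = q" using g by (intro nth_equalityI) auto
  have "successively (\<lambda>a b. head G a = tail G b) ?p"
    unfolding successively_conv_nth using g by auto
  moreover have "head G (last ?p) = tail G (hd ?p)"
    using g[of "?n - 1"] g[of 0] n by (simp add: last_map hd_map)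
  moreover have "set ?p \<subseteq> arcs G" using g by auto
  ultimately show ?thesis using t assms cycle_iff_cyc by metis
qed

lemma disjoint_cycles_packing:
  assumes "disjoint_cycles G k C"
  shows "packing (verts G) k (map (tail G) ` C)"
proof -
  have C: "finite C" "card C = k" "\<And>p. p \<in> C \<Longrightarrow> cyc (map (tail G) p)"
    "\<And>p q. p \<in> C \<Longrightarrow> q \<in> C \<Longrightarrow> p \<noteq> q \<Longrightarrow> tail G ` set p \<inter> tail G ` set q = {}"
    using assms cycle_iff_cyc unfolding disjoint_cycles_def by auto
  have "inj_on (map (tail G)) C"
  proof (rule inj_onI, rule ccontr)
    fix p q assume pq: "p \<in> C" "q \<in> C" "map (tail G) p = map (tail G) q" "p \<noteq> q"
    then have "tail G ` set p = {}" using C(4)[OF pq(1,2,4)] by (metis inf.idem list.set_map)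
    then show False using C(3)[OF pq(1)] by (simp add: cyc_def)
  qed
  then have "card (map (tail G) ` C) = k" using C(2) by (simp add: card_image)
  moreover have "set (map (tail G) p) \<subseteq> verts G" if "p \<in> C" for p using cyc_in_V C(3)[OF that] by blast
  moreover have "set (map (tail G) p) \<inter> set (map (tail G) q) = {}"
    if "p \<in> C" "q \<in> C" "map (tail G) p \<noteq> map (tail G) q" for p q
  proof -
    have "p \<noteq> q" using that(3) by blast
    then show ?thesis using C(4)[OF that(1,2)] by simp
  qed
  ultimately show ?thesis unfolding packing_def using C(1,3) by blast
qed

lemma packing_disjoint_cycles:
  assumes "packing (verts G) k F"
  shows "\<exists>C. disjoint_cycles G k C \<and> length ` C = length ` F"
proof -
  have F: "finite F" "card F = k" "\<And>q. q \<in> F \<Longrightarrow> cyc q"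
    "\<And>p q. p \<in> F \<Longrightarrow> q \<in> F \<Longrightarrow> p \<noteq> q \<Longrightarrow> set p \<inter> set q = {}"
    using assms unfolding packing_def by auto
  have "\<forall>q\<in>F. \<exists>p. cycle p \<and> map (tail G) p = q" using cyc_imp_cycle F(3) by blast
  then obtain a where a: "\<And>q. q \<in> F \<Longrightarrow> cycle (a q)" "\<And>q. q \<in> F \<Longrightarrow> map (tail G) (a q) = q" by metis
  have inj: "inj_on a F" using a(2) by (metis inj_onI)
  have ts: "tail G ` set (a q) = set q" if "q \<in> F" for q using a(2)[OF that] by (metis list.set_map)
  have "length (a q) = length q" if "q \<in> F" for q using a(2)[OF that] by (metis length_map)
  then have "length ` a ` F = length ` F" by (simp add: image_image)
  moreover have "disjoint_cycles G k (a ` F)"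
    unfolding disjoint_cycles_def using F a ts inj by (auto simp: card_image)
  ultimately show ?thesis by blast
qed

lemma card_image_le_one_iff: "finite A \<Longrightarrow> card (f ` A) \<le> 1 \<longleftrightarrow> (\<forall>x\<in>A. \<forall>y\<in>A. f x = f y)"
  by (auto simp: card_le_Suc0_iff_eq)

text \<open>
  The value 1 includes the existence of a packing, because without one the supremum is 0.
\<close>
lemma kappa_eq_1_iff:
  assumes "0 < k"
  shows "kappa k G = 1 \<longleftrightarrow> (\<exists>F. packing (verts G) k F) \<and> uniform (verts G) k"
proof
  assume kap: "kappa k G = 1"
  have ne: "{C. disjoint_cycles G k C} \<noteq> {}"
  proof
    assume "{C. disjoint_cycles G k C} = {}"
    then have "kappa k G = 0" unfolding kappa_def by (simp only: image_empty Sup_nat_empty)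
    then show False using kap by simp
  qed
  then obtain C where C: "disjoint_cycles G k C" by blast
  have le: "num_lengths C' \<le> 1" if "disjoint_cycles G k C'" for C'
  proof -
    have "num_lengths C' \<le> Max (num_lengths ` {C. disjoint_cycles G k C})"
      using that finite_num_lengths by (intro Max_ge) auto
    then show ?thesis using kap kappa_eq_Max[OF C] by simp
  qed
  have "uniform (verts G) k" unfolding uniform_def
  proof (intro allI impI)
    fix F assume F: "packing (verts G) k F"
    then obtain C' where C': "disjoint_cycles G k C'" "length ` C' = length ` F" using packing_disjoint_cycles by blast
    then have "card (length ` F) \<le> 1" using le[OF C'(1)] by (simp add: num_lengths_def)
    then show "\<forall>p\<in>F. \<forall>q\<in>F. length p = length q"
      using card_image_le_one_iff F unfolding packing_def by blast
  qed
  then show "(\<exists>F. packing (verts G) k F) \<and> uniform (verts G) k" using disjoint_cycles_packing[OF C] by blast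
next
  assume R: "(\<exists>F. packing (verts G) k F) \<and> uniform (verts G) k"
  then obtain C where C: "disjoint_cycles G k C" using packing_disjoint_cycles by blast
  have one: "num_lengths C' = 1" if C': "disjoint_cycles G k C'" for C'
  proof -
    have fin: "finite C'" "card C' = k" using C' unfolding disjoint_cycles_def by blast+
    have ne: "C' \<noteq> {}"
    proof
      assume "C' = {}"
      then have "card C' = 0" by (simp only: card.empty)
      then show False using fin(2) assms by linarith
    qed
    have "\<forall>p\<in>map (tail G) ` C'. \<forall>q\<in>map (tail G) ` C'. length p = length q"
      by (rule R[THEN conjunct2, unfolded uniform_def, THEN spec, THEN mp, OF disjoint_cycles_packing[OF C']])
    then have "\<forall>p\<in>C'. \<forall>q\<in>C'. length p = length q" unfolding ball_simps length_map .
    then have "card (length ` C') \<le> 1" using card_image_le_one_iff[OF fin(1), of length] by blast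
    moreover have "0 < card (length ` C')" using fin(1) ne by (simp add: card_gt_0_iff)
    ultimately show ?thesis by (simp add: num_lengths_def)
  qed
  have "num_lengths ` {C. disjoint_cycles G k C} = {1}" using one C by auto
  then show "kappa k G = 1" using kappa_eq_Max[OF C] by simp
qed

section \<open>Strong components\<close>

lemma walk_reachable: "(step S ^^ n) u v \<Longrightarrow> u \<in> verts G \<Longrightarrow> u \<rightarrow>\<^sup>* v"
proof (induction n arbitrary: v)
  case (Suc n)
  from Suc.prems(1) obtain w where "(step S ^^ n) u w" "step S w v" by auto
  moreover from this have "w \<rightarrow> v" by (simp add: step_def)
  ultimately show ?case using Suc.IH[of w] Suc.prems(2) reachable_adj_trans[of u w v] by blast
qed auto

lemma reachable_out_closed:
  assumes "u \<rightarrow>\<^sup>* v" "u \<in> A" "out_closed (verts G) A"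
  shows "v \<in> A"
  using assms
proof (induction rule: reachable_induct)
  case (step x y)
  then show ?case using adj_in_verts unfolding out_closed_def by blast
qed

lemma terminal_sccs_verts:
  assumes K: "terminal (verts G) K"
  shows "K \<in> sccs_verts"
  unfolding sccs_verts_def
proof (intro CollectI conjI ballI allI impI)
  show "K \<noteq> {}" using terminal_sub(3)[OF K] .
next
  fix u v assume uv: "u \<in> K" "v \<in> K"
  then obtain n where "(step K ^^ n) u v" using strong_reach[OF terminal_sub(2)[OF K]] by blast
  then show "u \<rightarrow>\<^sup>* v" using walk_reachable terminal_sub(1)[OF K] uv by blast
next
  fix u v assume "u \<in> K" "v \<notin> K"
  then show "\<not> u \<rightarrow>\<^sup>* v \<or> \<not> v \<rightarrow>\<^sup>* u" using reachable_out_closed K unfolding terminal_def by blast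
qed

text \<open>
  A path from \<open>u\<close> to another vertex of its component stays in the component, so \<open>u\<close> has an
  out-neighbour there.
\<close>
lemma sccs_verts_cyc:
  assumes S: "S \<in> sccs_verts" "1 < card S"
  shows "\<exists>q. cyc q \<and> set q \<subseteq> S"
proof -
  have Sv: "S \<subseteq> verts G" using sccs_verts_subsets S by blast
  have "0 < outd S u" if u: "u \<in> S" for u
  proof -
    have "\<not> S \<subseteq> {u}" using S(2) card_mono[of "{u}" S] by auto
    then obtain v where v: "v \<in> S" "v \<noteq> u" by blast
    have "u \<rightarrow>\<^sup>* v" "v \<rightarrow>\<^sup>* u" using S(1) u v unfolding sccs_verts_def by blast+
    from \<open>u \<rightarrow>\<^sup>* v\<close> obtain w where w: "u \<rightarrow> w" "w \<rightarrow>\<^sup>* v"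
      using v(2) by (cases rule: converse_reachable_cases) auto
    then have "u \<rightarrow>\<^sup>* w" "w \<rightarrow>\<^sup>* u" using \<open>v \<rightarrow>\<^sup>* u\<close> reachable_trans by blast+
    then have "w \<in> S" using S(1) u unfolding sccs_verts_def by blast
    then have "w \<in> outs S u" using w by (simp add: outs_def)
    then show ?thesis by (auto simp: card_gt_0_iff)
  qed
  moreover have "S \<noteq> {}" using S(2) by auto
  ultimately show ?thesis using short_cyc_outd finite_sub[OF Sv] by metis
qed

lemma cyc_in_scc:
  assumes "cyc q"
  shows "\<exists>S\<in>sccs_verts. set q \<subseteq> S \<and> 1 < card S"
proof -
  let ?u = "q ! 0"
  have n: "0 < length q" using assms by (auto simp: cyc_def)
  have u: "?u \<in> verts G" using cyc_in_V[OF assms] n by auto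
  have "?u \<rightarrow>\<^sup>* v \<and> v \<rightarrow>\<^sup>* ?u" if "v \<in> set q" for v
  proof -
    obtain i where i: "i < length q" "q ! i = v" using \<open>v \<in> set q\<close> by (auto simp: in_set_conv_nth)
    have "v \<in> verts G" using that cyc_in_V[OF assms] by blast
    then show ?thesis using walk_reachable[OF cyc_walk[OF assms, of 0 i]] walk_reachable[OF cyc_wrap[OF assms i(1)]] u i by simp
  qed
  then have sub: "set q \<subseteq> scc_of ?u" by (auto simp: scc_of_def)
  have S: "scc_of ?u \<in> sccs_verts" using scc_of_in_sccs_verts[OF u] .
  have "card (set q) = length q" using assms by (simp add: cyc_def distinct_card)
  moreover have "card (set q) \<le> card (scc_of ?u)"
    using sub finite_sub sccs_verts_subsets[OF S] by (intro card_mono) auto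
  ultimately have "1 < card (scc_of ?u)" using cyc_ge3[OF assms] by simp
  then show ?thesis using S sub by blast
qed

lemma nontrivial_scc_iff: "nontrivial_scc G H \<longleftrightarrow> (\<exists>S\<in>sccs_verts. 1 < card S \<and> H = G \<restriction> S)"
  unfolding nontrivial_scc_def sccs_conv_sccs_verts by auto

section \<open>Membership in BT and the characterization\<close>

lemma dominates_induced_iff: "(u \<rightarrow>\<^bsub>G \<restriction> K\<^esub> v) \<longleftrightarrow> u \<in> K \<and> v \<in> K \<and> u \<rightarrow> v"
  by (auto simp: arcs_ends_conv)

lemma bipartition_edge_iff:
  "X \<noteq> Y \<Longrightarrow> {x, y} \<in> complete_multipartite_edges {X, Y} \<longleftrightarrow> x \<in> X \<and> y \<in> Y \<or> x \<in> Y \<and> y \<in> X"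
  unfolding complete_multipartite_edge_iff by blast

text \<open>
  Take the small class as \<open>Y\<close>, enumerated by \<open>y\<close>, and the out-neighbourhood of \<open>y i\<close> as the \<open>i\<close>-th part of \<open>X\<close>.  Unique
  in-neighbours make these parts a partition of \<open>X\<close>.
\<close>
lemma BT_memberI:
  assumes k: "2 \<le> k" and K: "strong K" "fits 4 K" and deg: "\<And>v. v \<in> K \<Longrightarrow> 2 * k - 1 \<le> outd K v"
    and z: "z \<in> K" "card {v \<in> K. part_of P v = part_of P z} = 2 * k"
  shows "\<exists>n. (\<forall>i\<in>{1..2 * k}. 2 * k - 1 \<le> n i) \<and> G \<restriction> K \<in> BT k n"
proof -
  have KV: "K \<subseteq> verts G" "card (part_of P ` K) \<le> 2" using K(2) by (auto simp: fits_def)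
  have finK: "finite K" using finite_sub[OF KV(1)] .
  define Y where "Y = {v \<in> K. part_of P v = part_of P z}"
  define X where "X = K - Y"
  have kk: "2 * k = Suc (2 * k - 1)" using k by simp
  have cY: "card Y = 2 * k" using z(2) by (simp add: Y_def)
  have split: "(u \<in> X \<and> v \<in> Y) \<or> (u \<in> Y \<and> v \<in> X)" if uv: "u \<in> K" "v \<in> K" "part_of P u \<noteq> part_of P v" for u v
  proof -
    have "part_of P z = part_of P u \<or> part_of P z = part_of P v" using two_colours_eq[OF KV uv(1,2) z(1) uv(3)] .
    then show ?thesis using uv unfolding X_def Y_def by auto
  qed
  have diff: "part_of P x \<noteq> part_of P y" if "x \<in> X" "y \<in> Y" for x y using that by (auto simp: X_def Y_def)
  have one: "\<exists>y\<in>Y. y \<rightarrow> x \<and> (\<forall>y'\<in>Y - {y}. x \<rightarrow> y')" if "x \<in> X" for x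
  proof -
    have x: "x \<in> K" "part_of P x \<noteq> part_of P z" using that by (auto simp: X_def Y_def)
    have cY': "card Y \<le> Suc (2 * k - 1)" using cY kk by simp
    show ?thesis using unique_in_neighbour[OF K z(1) Y_def cY' deg x] by blast
  qed
  have finY: "finite Y" using finK by (simp add: Y_def)
  obtain y where "bij_betw y {1..card Y} Y" using ex_bij_betw_nat_finite_1[OF finY] by blast
  then have y: "inj_on y {1..2 * k}" "y ` {1..2 * k} = Y" using cY by (auto simp: bij_betw_def)
  have yY: "y i \<in> Y" if "i \<in> {1..2 * k}" for i using y(2) that by blast
  define Xs where "Xs i = outs K (y i)" for i
  have XsX: "Xs i \<subseteq> X" if "i \<in> {1..2 * k}" for i
  proof
    fix x assume "x \<in> Xs i"
    then have x: "x \<in> K" "y i \<rightarrow> x" by (auto simp: Xs_def outs_def)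
    then show "x \<in> X" using split[OF _ x(1) dominates_part_of[OF x(2)]] yY[OF that] by (auto simp: X_def Y_def)
  qed
  have Xs_iff: "y i \<rightarrow> x \<longleftrightarrow> x \<in> Xs i" if "x \<in> X" for x i using that by (auto simp: X_def Xs_def outs_def)
  have back_arc: "x \<rightarrow> y j" if "x \<in> Xs i" "i \<in> {1..2 * k}" "j \<in> {1..2 * k}" "i \<noteq> j" for x i j
  proof -
    have x: "x \<in> X" "y i \<rightarrow> x" using XsX that Xs_iff by blast+
    obtain y0 where y0: "y0 \<in> Y" "\<And>y'. y' \<in> Y \<Longrightarrow> y' \<noteq> y0 \<Longrightarrow> x \<rightarrow> y'" using one[OF x(1)] by blast
    have "y i = y0" using y0(2)[OF yY[OF that(2)]] arc_asym[OF x(2)] by blast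
    moreover have "y i \<noteq> y j" using y(1) that by (metis inj_onD)
    ultimately show ?thesis using y0(2)[OF yY[OF that(3)]] by simp
  qed
  have X_eq: "X = (\<Union>i\<in>{1..2 * k}. Xs i)"
  proof
    show "X \<subseteq> (\<Union>i\<in>{1..2 * k}. Xs i)"
    proof
      fix x assume x: "x \<in> X"
      then obtain y0 where "y0 \<in> Y" "y0 \<rightarrow> x" using one by blast
      then obtain i where "i \<in> {1..2 * k}" "y i \<rightarrow> x" using y(2) by blast
      then show "x \<in> (\<Union>i\<in>{1..2 * k}. Xs i)" using Xs_iff[OF x] by blast
    qed
  qed (use XsX in blast)
  have disj: "disjoint_family_on Xs {1..2 * k}"
    unfolding disjoint_family_on_def
  proof (intro ballI impI)
    fix i j assume ij: "i \<in> {1..2 * k}" "j \<in> {1..2 * k}" "i \<noteq> j"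
    show "Xs i \<inter> Xs j = {}"
    proof (rule ccontr)
      assume "Xs i \<inter> Xs j \<noteq> {}"
      then obtain x where x: "x \<in> Xs i" "x \<in> Xs j" by blast
      have "x \<rightarrow> y j" using back_arc[OF x(1) ij] .
      moreover have "y j \<rightarrow> x" using x(2) by (auto simp: Xs_def outs_def)
      ultimately show False using arc_asym by blast
    qed
  qed
  have i1: "1 \<in> {1..2 * k}" using k by simp
  have large: "2 * k - 1 \<le> card (Xs i)" if "i \<in> {1..2 * k}" for i
    using deg[of "y i"] yY[OF that] by (auto simp: Xs_def Y_def)
  have "Xs 1 \<noteq> {}" using large[OF i1] k by auto
  then have Xne: "X \<noteq> {}" using XsX[OF i1] by blast
  have Yne: "Y \<noteq> {}" using yY[OF i1] by blast
  have XY: "X \<inter> Y = {}" "X \<union> Y = K" by (auto simp: X_def Y_def)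
  then have neq: "X \<noteq> Y" using Yne by blast
  have part: "partition_on K {X, Y}"
    unfolding partition_on_def using XY Xne Yne by (auto simp: disjoint_def)
  have dig: "digraph (G \<restriction> K)" by (rule digraphI_induced) (rule induced_induce[OF KV(1)])
  have xor: "(u \<rightarrow>\<^bsub>G \<restriction> K\<^esub> v) \<noteq> (v \<rightarrow>\<^bsub>G \<restriction> K\<^esub> u)" if uv: "u \<in> X \<and> v \<in> Y \<or> u \<in> Y \<and> v \<in> X" for u v
  proof -
    have inK: "u \<in> K" "v \<in> K" using uv XY by blast+
    have "part_of P u \<noteq> part_of P v" using uv diff[of u v] diff[of v u] by metis
    moreover have "u \<in> verts G" "v \<in> verts G" using inK KV(1) by blast+
    ultimately have "(u \<rightarrow> v) \<noteq> (v \<rightarrow> u)" using dominates_xor by blast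
    then show ?thesis unfolding dominates_induced_iff using inK by simp
  qed
  have only: "u \<in> X \<and> v \<in> Y \<or> u \<in> Y \<and> v \<in> X" if "u \<rightarrow>\<^bsub>G \<restriction> K\<^esub> v" for u v
    using that split[of u v] dominates_part_of[of u v] unfolding dominates_induced_iff by blast
  have vs: "verts (G \<restriction> K) = \<Union>{X, Y}" using XY by simp
  have "orientation_of (G \<restriction> K) (\<Union>{X, Y}) (complete_multipartite_edges {X, Y})"
    unfolding orientation_of_def bipartition_edge_iff[OF neq]
    by (intro conjI dig vs allI impI; (rule xor | rule only); assumption)
  then have mt: "multipartite_tournament_on {X, Y} (G \<restriction> K)"
    unfolding multipartite_tournament_on_def using part by simp
  define Ys where "Ys i = {y i}" for i
  have Y_eq: "Y = (\<Union>i\<in>{1..2 * k}. Ys i)" using y(2) by (auto simp: Ys_def)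
  have disjY: "disjoint_family_on Ys {1..2 * k}" 
    unfolding disjoint_family_on_def Ys_def using inj_onD[OF y(1)] by blast
  let ?H = "G \<restriction> K"
  have arcs: "arcs ?H = (\<Union>i\<in>{1..2 * k}. \<Union>j\<in>{1..2 * k} - {i}. arcs_from_to ?H (Xs i) (Ys j)) \<union>
       (\<Union>i\<in>{1..2 * k}. arcs_from_to ?H (Ys i) (Xs i))" (is "_ = ?A \<union> ?B")
  proof
    show "arcs ?H \<subseteq> ?A \<union> ?B"
    proof
      fix e assume e: "e \<in> arcs ?H"
      then have eK: "tail G e \<in> K" "head G e \<in> K" and dom: "tail G e \<rightarrow> head G e" by (auto simp: arcs_ends_conv)
      from split[OF eK dominates_part_of[OF dom]] show "e \<in> ?A \<union> ?B"
      proof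
        assume a: "tail G e \<in> X \<and> head G e \<in> Y"
        then obtain i j where i: "i \<in> {1..2 * k}" "tail G e \<in> Xs i" and j: "j \<in> {1..2 * k}" "head G e = y j"
          using X_eq y(2) by blast
        have "i \<noteq> j"
        proof
          assume "i = j"
          then have "head G e \<rightarrow> tail G e" using i(2) j(2) by (auto simp: Xs_def outs_def)
          then show False using arc_asym[OF dom] by blast
        qed
        then have "e \<in> arcs_from_to ?H (Xs i) (Ys j)" "j \<in> {1..2 * k} - {i}"
          using e i j by (auto simp: arcs_from_to_def Ys_def)
        then show ?thesis using i(1) by blast
      next
        assume a: "tail G e \<in> Y \<and> head G e \<in> X"
        then obtain i where i: "i \<in> {1..2 * k}" "tail G e = y i" using y(2) by blast
        then have "head G e \<in> Xs i" using Xs_iff a dom by metis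
        then have "e \<in> arcs_from_to ?H (Ys i) (Xs i)" using e i by (auto simp: arcs_from_to_def Ys_def)
        then show ?thesis using i(1) by blast
      qed
    qed
  qed (auto simp: arcs_from_to_def)
  have "?H \<in> BT k (\<lambda>i. card (Xs i))"
    unfolding BT_def mem_Collect_eq
    by (rule exI[of _ X], rule exI[of _ Y], rule exI[of _ Xs], rule exI[of _ Ys])
       (intro conjI neq mt X_eq disj Y_eq disjY arcs ballI refl; simp add: Ys_def)
  moreover have "\<forall>i\<in>{1..2 * k}. 2 * k - 1 \<le> card (Xs i)" using large by (rule ballI)
  ultimately show ?thesis by (intro exI[of _ "\<lambda>i. card (Xs i)"] conjI)
qed

text \<open>
  The bipartition in the definition of \<open>BT\<close> agrees with the partite sets of the whole digraph, because in both two
  vertices are in different classes exactly when they are adjacent.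
\<close>
lemma BT_memberD:
  assumes K: "K \<subseteq> verts G" and BT: "G \<restriction> K \<in> BT k n"
  shows "fits 4 K \<and> (\<exists>z\<in>K. card {v \<in> K. part_of P v = part_of P z} = 2 * k)"
proof -
  obtain X Y Ys where XY: "X \<noteq> Y" "multipartite_tournament_on {X, Y} (G \<restriction> K)"
    and Y: "Y = (\<Union>i\<in>{1..2 * k}. Ys i)" "disjoint_family_on Ys {1..2 * k}" "\<forall>i\<in>{1..2 * k}. card (Ys i) = 1"
    using BT unfolding BT_def mem_Collect_eq by (elim exE conjE) (rule that)
  have part: "partition_on K {X, Y}" and ori: "orientation_of (G \<restriction> K) (\<Union>{X, Y}) (complete_multipartite_edges {X, Y})"
    using XY(2) by (auto simp: multipartite_tournament_on_def)
  have KXY: "K = X \<union> Y" using partition_onD1[OF part] by simp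
  have "X \<inter> Y = {}" using partition_onD2[OF part] XY(1) by (auto simp: disjoint_def)
  have ne: "X \<noteq> {}" "Y \<noteq> {}" using partition_onD3[OF part] by auto
  have adj: "part_of P u \<noteq> part_of P v \<longleftrightarrow> u \<in> X \<and> v \<in> Y \<or> u \<in> Y \<and> v \<in> X" if uv: "u \<in> K" "v \<in> K" for u v
  proof -
    have "u \<in> X \<and> v \<in> Y \<or> u \<in> Y \<and> v \<in> X \<longleftrightarrow> (u \<rightarrow>\<^bsub>G \<restriction> K\<^esub> v) \<or> (v \<rightarrow>\<^bsub>G \<restriction> K\<^esub> u)"
      using ori unfolding orientation_of_def bipartition_edge_iff[OF XY(1)] by blast
    also have "\<dots> \<longleftrightarrow> part_of P u \<noteq> part_of P v"
      unfolding dominates_induced_iff using uv K dominates_xor[of u v] dominates_part_of by blast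
    finally show ?thesis by blast
  qed
  obtain x z where xz: "x \<in> X" "z \<in> Y" using ne by blast
  have "part_of P v = part_of P z \<longleftrightarrow> v \<in> Y" if "v \<in> K" for v
    using adj[of v z] xz KXY that \<open>X \<inter> Y = {}\<close> by blast
  then have "{v \<in> K. part_of P v = part_of P z} = Y" using KXY by blast
  moreover have "card Y = 2 * k"
  proof -
    have "finite (Ys i)" if "i \<in> {1..2 * k}" for i using Y(3) that by (metis card.infinite zero_neq_one)
    then have "card Y = (\<Sum>i\<in>{1..2 * k}. card (Ys i))"
      unfolding Y(1) using Y(2) by (intro card_UN_disjoint) (auto simp: disjoint_family_on_def)
    then show ?thesis using Y(3) by simp
  qed
  moreover have "part_of P v = part_of P x \<or> part_of P v = part_of P z" if "v \<in> K" for v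
    using adj[of v z] adj[of v x] xz KXY that \<open>X \<inter> Y = {}\<close> by blast
  then have "part_of P ` K \<subseteq> {part_of P x, part_of P z}" by blast
  then have "card (part_of P ` K) \<le> 2"
    using card_mono[of "{part_of P x, part_of P z}" "part_of P ` K"]
      card_insert_le_m1[of 2 "{part_of P z}" "part_of P x"] by simp
  then have "fits 4 K" using K by (simp add: fits_def)
  ultimately show ?thesis using xz KXY by blast
qed

lemma kappa_1_imp_BT:
  assumes k: "2 \<le> k" and P3: "card P = 3" and deg: "2 * k - 1 \<le> min_out_degree G" and hom: "uniform (verts G) k"
  shows "\<exists>D'. terminal_scc G D' \<and> (\<forall>H. nontrivial_scc G H \<longleftrightarrow> H = D') \<and>
    (\<exists>n. (\<forall>i\<in>{1..2 * k}. n i \<ge> 2 * k - 1) \<and> D' \<in> BT k n)"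
proof -
  have degv: "2 * k - 1 \<le> outd (verts G) v" if "v \<in> verts G" for v
    using min_out_degree_le[OF that] deg by simp
  have "P \<noteq> {}" using P3 by auto
  then have ne: "verts G \<noteq> {}" using partition_onD1[OF partition_parts] partition_onD3[OF partition_parts] by auto
  have c3: "card (part_of P ` verts G) \<le> 3" using card_colours P3 by simp
  obtain K z where K: "terminal (verts G) K" "fits 4 K" and z: "z \<in> K" "card {v \<in> K. part_of P v = part_of P z} = 2 * k"
    and all: "\<And>q. cyc q \<Longrightarrow> set q \<inter> K \<noteq> {}"
    using uniform_structure[OF k c3 ne degv hom] by blast
  have KS: "K \<in> sccs_verts" using terminal_sccs_verts[OF K(1)] .
  have "finite K" using finite_sub[OF terminal_sub(1)[OF K(1)]] .
  then have "card {v \<in> K. part_of P v = part_of P z} \<le> card K" by (intro card_mono) auto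
  then have cK: "1 < card K" using z(2) k by linarith
  have only: "H = G \<restriction> K" if H: "nontrivial_scc G H" for H
  proof -
    from H[unfolded nontrivial_scc_iff]
    obtain S where S: "S \<in> sccs_verts" "1 < card S" "H = G \<restriction> S" by (elim bexE conjE)
    obtain q where "cyc q" "set q \<subseteq> S" using sccs_verts_cyc[OF S(1,2)] by blast
    then have "S \<inter> K \<noteq> {}" using all by blast
    then have "S = K" using sccs_verts_disjoint[OF S(1) KS] by blast
    then show ?thesis using S(3) by simp
  qed
  have nt: "nontrivial_scc G (G \<restriction> K)" unfolding nontrivial_scc_iff using KS cK by (intro bexI[of _ K] conjI refl)
  have terminal_K: "terminal_scc G (G \<restriction> K)"
    unfolding terminal_scc_def
  proof
    show "G \<restriction> K \<in> sccs" using KS by (simp add: sccs_conv_sccs_verts)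
    have "head G e \<in> K" if "e \<in> arcs G" "tail G e \<in> K" for e
      using terminalD[OF K(1) that(2), of "head G e"] that(1) by (auto simp: arcs_ends_conv)
    then show "\<not> (\<exists>e\<in>arcs G. tail G e \<in> verts (G \<restriction> K) \<and> head G e \<notin> verts (G \<restriction> K))" by auto
  qed
  have "2 * k - 1 \<le> outd K v" if "v \<in> K" for v
    using terminal_outd[OF K(1) that] degv that terminal_sub(1)[OF K(1)] by auto
  then have "\<exists>n. (\<forall>i\<in>{1..2 * k}. n i \<ge> 2 * k - 1) \<and> G \<restriction> K \<in> BT k n"
    by (rule BT_memberI[OF k terminal_sub(2)[OF K(1)] K(2) _ z])
  moreover have "\<forall>H. nontrivial_scc G H \<longleftrightarrow> H = G \<restriction> K" using only nt by metis
  ultimately show ?thesis using terminal_K by (intro exI[of _ "G \<restriction> K"] conjI)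
qed

text \<open>Every cycle lies in a nontrivial strong component, and there is only one.\<close>
lemma BT_imp_uniform:
  assumes comp: "\<And>H. nontrivial_scc G H \<longleftrightarrow> H = D'" and BT: "D' \<in> BT k n"
  shows "uniform (verts G) k"
proof -
  have "nontrivial_scc G D'" using comp by blast
  from this[unfolded nontrivial_scc_iff] obtain K where K: "K \<in> sccs_verts" "D' = G \<restriction> K" by (elim bexE conjE)
  have KV: "K \<subseteq> verts G" using sccs_verts_subsets K by blast
  obtain z where z: "fits 4 K" "z \<in> K" "card {v \<in> K. part_of P v = part_of P z} = 2 * k"
    using BT_memberD[OF KV] BT K(2) by blast
  have inK: "set q \<subseteq> K" if q: "cyc q" for q
  proof -
    obtain S where S: "S \<in> sccs_verts" "set q \<subseteq> S" "1 < card S" using cyc_in_scc[OF q] by blast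
    then have "nontrivial_scc G (G \<restriction> S)" unfolding nontrivial_scc_iff by (intro bexI[of _ S] conjI refl)
    then have "G \<restriction> S = G \<restriction> K" using comp K(2) by simp
    then have "verts (G \<restriction> S) = verts (G \<restriction> K)" by simp
    then show ?thesis using S(2) by simp
  qed
  show ?thesis unfolding uniform_def
  proof (intro allI impI ballI)
    fix F p q assume F: "packing (verts G) k F" "p \<in> F" "q \<in> F"
    then have "packing K k F" using inK unfolding packing_def by blast
    then show "length p = length q" using packing_length_four[OF z] F by metis
  qed
qed

end

theorem theorem2p9:
  fixes D :: "('a, 'b) pre_digraph" and k :: nat
  assumes "k \<ge> 2"
    and "partite_tournament 3 D"
    and "min_out_degree D \<ge> 2 * k - 1"
  shows "kappa k D = 1 \<longleftrightarrow>
    (\<exists>D'. terminal_scc D D' \<and>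
          (\<forall>H. nontrivial_scc D H \<longleftrightarrow> H = D') \<and>
          (\<exists>n. (\<forall>i\<in>{1..2 * k}. n i \<ge> 2 * k - 1) \<and> D' \<in> BT k n))"
proof -
  obtain P where P: "finite P" "card P = 3" "multipartite_tournament_on P D"
    using assms(2) by (auto simp: partite_tournament_def)
  then have "digraph D" by (simp add: multipartite_tournament_on_def orientation_of_def)
  then interpret multipartite_tournament D P
    using P by (simp add: multipartite_tournament_def multipartite_tournament_axioms_def)
  have "P \<noteq> {}" using P(2) by auto
  then have ne: "verts D \<noteq> {}" using partition_onD1[OF partition_parts] partition_onD3[OF partition_parts] by auto
  have fit: "fits 3 (verts D)" using card_colours P(2) by (simp add: fits_def)
  have deg: "2 * k - 1 \<le> outd (verts D) v" if "v \<in> verts D" for v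
    using min_out_degree_le[OF that] assms(3) by simp
  have "\<exists>F. packing (verts D) k F" using packing_exists[OF fit ne deg] by blast
  then have "kappa k D = 1 \<longleftrightarrow> uniform (verts D) k" using kappa_eq_1_iff assms(1) by simp
  then show ?thesis using kappa_1_imp_BT[OF assms(1) P(2) assms(3)] BT_imp_uniform by blast
qed

end
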